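(* Let $p$ be an odd prime. Two cusps $a/c$ and $a'/c'$ (written with $\gcd(a,c)=\gcd(a',c')=1$) have the same image under $F$ if and only if $\begin{pmatrix}a\\c\end{pmatrix}\sim\begin{pmatrix}a'\\c'\end{pmatrix}$, i.e., there exists $\mu\in(\mathbb{Z}/4p\mathbb{Z})^*$ with $\begin{pmatrix}a'\\c'\end{pmatrix}\equiv\mu\begin{pmatrix}a\\c\end{pmatrix}\pmod{4p}$.
   Context: $\Gamma(N)\subset SL(2,\mathbb{Z})$ is the principal congruence subgroup of level $N$, $X(N)$ its compactified modular curve, $\mathcal{M}_k(\Gamma)$ the space of weight-$k$ holomorphic modular forms on $\Gamma$. For $\alpha=\begin{pmatrix}a&b\\c&d\end{pmatrix}$ with $\det\alpha>0$, $(f|\alpha)(z)=f(\alpha z)(cz+d)^{-1}$. With $q=e^{2\pi iz}$, $\theta(z)=\sum_{n\in\mathbb{Z}}q^{n^2}$, $\phi(z)=\theta(z)-\theta((z+2)/4)$, $M=\theta^2$, $N=2\theta\phi$, $P=\phi^2$ (a basis of $\mathcal{M}_1(\Gamma(4))$). $V\subset\mathcal{M}_1(\Gamma(4p))$ is the span of all $f|\alpha$ with $f\in\mathcal{M}_1(\Gamma(4))$ and $\alpha$ a primitive integral matrix of determinant $1$ or $p$; equivalently, the span of $f(z)$, $f((z+b)/p)$ for $f\in\{M,N,P\}$, $0\le b<p$. Let $f_1,\dots,f_d$ be a basis of $V$; $F$ is the morphism $X(4p)\to\mathbb{P}^{d-1}$ induced by $z\mapsto[f_1(z):\cdots:f_d(z)]$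 on the extended upper half plane $\mathcal{H}\cup\mathbb{P}^1(\mathbb{Q})$; its value at a cusp $a/c=\gamma\infty$ ($\gamma\in SL(2,\mathbb{Z})$) is given by the constant terms of the $q$-expansions of the $f_i|\gamma$. A cusp $a/c\in\mathbb{P}^1(\mathbb{Q})$ is represented by the primitive vector $(a,c)^T$ (up to sign). *)

theory Defs
  imports
    "HOL-Analysis.Analysis"
    "HOL-Number_Theory.Cong"
    "HOL-Library.Function_Algebras"
begin

text \<open>
  A function on the upper half plane is encoded as a function on all of
  \<open>\<complex>\<close> that vanishes off the upper half plane, so that equality and
  linear independence are those of functions on the upper half plane.
\<close>

definition uhp :: "complex set" where
  "uhp = {z. Im z > 0}"

text \<open>The complex vector space of functions \<open>\<complex> \<rightarrow> \<complex>\<close>, with pointwise operations.\<close>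

global_interpretation cfun:
  vector_space "\<lambda>(c::complex) (f :: complex \<Rightarrow> complex) z. c * f z"
  by unfold_locales (auto simp: fun_eq_iff algebra_simps)

definition SL2Z :: "(int^2^2) set" where
  "SL2Z = {\<gamma>. det \<gamma> = 1}"

definition principal_congruence_subgroup :: "nat \<Rightarrow> (int^2^2) set" where
  "principal_congruence_subgroup N =
     {\<gamma> \<in> SL2Z. \<forall>i j. [\<gamma> $ i $ j = mat 1 $ i $ j] (mod int N)}"

definition primitive_matrix :: "int^2^2 \<Rightarrow> bool" where
  "primitive_matrix \<alpha> \<longleftrightarrow> Gcd {\<alpha>$1$1, \<alpha>$1$2, \<alpha>$2$1, \<alpha>$2$2} = 1"

text \<open>Weight 1 slash operator, for \<open>det \<alpha> > 0\<close>, without a determinant factor.\<close>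

definition slash :: "(complex \<Rightarrow> complex) \<Rightarrow> int^2^2 \<Rightarrow> complex \<Rightarrow> complex" where
  "slash f \<alpha> z =
     (if z \<in> uhp
      then f ((of_int (\<alpha>$1$1) * z + of_int (\<alpha>$1$2)) / (of_int (\<alpha>$2$1) * z + of_int (\<alpha>$2$2)))
             / (of_int (\<alpha>$2$1) * z + of_int (\<alpha>$2$2))
      else 0)"

text \<open>\<open>g\<close> has the expansion \<open>\<Sum>n\<ge>0. a\<^sub>n q\<^sup>n\<^sup>/\<^sup>h\<close> with \<open>q = exp (2\<pi>iz)\<close>.\<close>

definition has_q_expansion :: "nat \<Rightarrow> (complex \<Rightarrow> complex) \<Rightarrow> (nat \<Rightarrow> complex) \<Rightarrow> bool" where
  "has_q_expansion h g a \<longleftrightarrow>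
     (\<forall>z\<in>uhp. (\<lambda>n. a n * exp (2 * of_real pi * \<i> * z * of_nat n / of_nat h)) sums g z)"

definition const_term :: "nat \<Rightarrow> (complex \<Rightarrow> complex) \<Rightarrow> complex" where
  "const_term h g = (THE c. \<exists>a. has_q_expansion h g a \<and> a 0 = c)"

text \<open>
  Holomorphic modular forms of weight 1 on \<open>\<Gamma>(N)\<close>. Holomorphy at the cusps says
  that every \<open>f|\<gamma>\<close> has an expansion in nonnegative powers of \<open>q\<^sup>1\<^sup>/\<^sup>N\<close>: the group
  \<open>\<Gamma>(N)\<close> is normal in \<open>SL(2,\<int>)\<close>, so every \<open>f|\<gamma>\<close> has period \<open>N\<close>.
\<close>

definition modular_forms1 :: "nat \<Rightarrow> (complex \<Rightarrow> complex) set" where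
  "modular_forms1 N =
     {f. f holomorphic_on uhp \<and> (\<forall>z. z \<notin> uhp \<longrightarrow> f z = 0) \<and>
         (\<forall>\<gamma>\<in>principal_congruence_subgroup N. slash f \<gamma> = f) \<and>
         (\<forall>\<gamma>\<in>SL2Z. \<exists>a. has_q_expansion N (slash f \<gamma>) a)}"

definition V :: "nat \<Rightarrow> (complex \<Rightarrow> complex) set" where
  "V p = cfun.span {slash f \<alpha> | f \<alpha>.
           f \<in> modular_forms1 4 \<and> primitive_matrix \<alpha> \<and> (det \<alpha> = 1 \<or> det \<alpha> = int p)}"

definition is_basis :: "nat \<Rightarrow> (nat \<Rightarrow> complex \<Rightarrow> complex) \<Rightarrow> (complex \<Rightarrow> complex) set \<Rightarrow> bool" where
  "is_basis d f W \<longleftrightarrow>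
     inj_on f {1..d} \<and> cfun.independent (f ` {1..d}) \<and> cfun.span (f ` {1..d}) = W"

text \<open>
  The point \<open>[v\<^sub>1 : \<dots> : v\<^sub>d]\<close> of \<open>\<P>\<^sup>d\<^sup>-\<^sup>1\<close> as the set of its homogeneous coordinate
  vectors; only the entries with index in \<open>{1..d}\<close> matter.
\<close>

definition proj_point :: "nat \<Rightarrow> (nat \<Rightarrow> complex) \<Rightarrow> (nat \<Rightarrow> complex) set" where
  "proj_point d v = {w. \<exists>t. t \<noteq> 0 \<and> (\<forall>i\<in>{1..d}. w i = t * v i)}"

text \<open>
  A matrix \<open>\<gamma> \<in> SL(2,\<int>)\<close> with \<open>\<gamma>\<infinity> = a/c\<close>, for coprime \<open>a\<close>, \<open>c\<close>. It is unique
  up to right multiplication by translations, which do not affect constant terms.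
\<close>

definition cusp_matrix :: "int \<Rightarrow> int \<Rightarrow> int^2^2" where
  "cusp_matrix a c = (SOME \<gamma>. \<gamma> \<in> SL2Z \<and> \<gamma>$1$1 = a \<and> \<gamma>$2$1 = c)"

lemma cusp_matrix:
  assumes "coprime a c"
  shows "cusp_matrix a c \<in> SL2Z" "cusp_matrix a c $1$1 = a" "cusp_matrix a c $2$1 = c"
proof -
  obtain u v where uv: "u * a + v * c = 1"
    using assms bezout_int[of a c] by auto
  define \<gamma> :: "int^2^2" where "\<gamma> = vector [vector [a, - v], vector [c, u]]"
  have "\<gamma> \<in> SL2Z \<and> \<gamma>$1$1 = a \<and> \<gamma>$2$1 = c"
    using uv by (simp add: \<gamma>_def SL2Z_def det_2 algebra_simps)
  then have "cusp_matrix a c \<in> SL2Z \<and> cusp_matrix a c $1$1 = a \<and> cusp_matrix a c $2$1 = c"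
    unfolding cusp_matrix_def by (rule someI)
  then show "cusp_matrix a c \<in> SL2Z" "cusp_matrix a c $1$1 = a" "cusp_matrix a c $2$1 = c"
    by auto
qed

text \<open>
  The value at the cusp \<open>a/c\<close> of the map \<open>X(4p) \<rightarrow> \<P>\<^sup>d\<^sup>-\<^sup>1\<close> induced by \<open>f\<^sub>1, \<dots>, f\<^sub>d \<in> V p\<close>.
  Elements of \<open>V p\<close> have level \<open>4p\<close>, hence the expansions in powers of \<open>q\<^sup>1\<^sup>/\<^sup>4\<^sup>p\<close>.
\<close>

definition F_at_cusp ::
  "nat \<Rightarrow> nat \<Rightarrow> (nat \<Rightarrow> complex \<Rightarrow> complex) \<Rightarrow> int \<Rightarrow> int \<Rightarrow> (nat \<Rightarrow> complex) set" where
  "F_at_cusp p d f a c =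
     proj_point d (\<lambda>i. const_term (4 * p) (slash (f i) (cusp_matrix a c)))"

end

theory Submission
  imports
    Defs
    "HOL-Complex_Analysis.Complex_Analysis"
    "HOL-Real_Asymp.Real_Asymp"
begin

text \<open>
  For \<open>f\<close> of level 4 and \<open>\<alpha>\<close> of determinant 1 or \<open>p\<close>, write the first column of \<open>\<alpha>\<gamma>\<close> as \<open>A\<close> times a
  primitive vector \<open>(x, y)\<close> and put \<open>D = det \<alpha> / A\<close>. The constant term of \<open>(f|\<alpha>)|\<gamma>\<close> is then \<open>1 / D\<close>
  times that of \<open>f\<close> at \<open>(x, y)\<close>, which up to sign depends only on \<open>\<plusminus>(x, y)\<close> modulo 4. Multiplying the
  cusp by a unit modulo \<open>4p\<close> preserves \<open>A\<close>, hence scales all constant terms by the same sign.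

  Conversely, move the first cusp to \<open>(1, 0)\<close> by an element of \<open>SL(2,\<int>)\<close> and let \<open>(u, w)\<close> be the image
  of the second one. Comparing the constant terms of the three theta squares gives \<open>4 | w\<close> and a
  proportionality factor of absolute value 1; the matrix \<open>diag(p, 1)\<close> has \<open>A = p\<close> at \<open>(1, 0)\<close>, and would
  produce a factor of size at most \<open>1 / p\<close> at \<open>(u, w)\<close> unless \<open>p | w\<close>. Then \<open>\<mu> = u\<close> works.

  The one analytic input, the inversion formula for the theta squares, comes from the residues of
  \<open>\<pi> / (sin (\<pi>w) cosh (\<pi>tw))\<close> at its two rows of poles, followed by analytic continuation in \<open>t\<close>.
\<close>

no_notation fps_nth (infixl \<open>$\<close> 75)

section \<open>Integral matrices and the slash operator\<close>

definition mat2 :: "int \<Rightarrow> int \<Rightarrow> int \<Rightarrow> int \<Rightarrow> int^2^2" where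
  "mat2 a b c d = vector [vector [a, b], vector [c, d]]"

lemma mat2_nth [simp]:
  "mat2 a b c d $ 1 $ 1 = a" "mat2 a b c d $ 1 $ 2 = b"
  "mat2 a b c d $ 2 $ 1 = c" "mat2 a b c d $ 2 $ 2 = d"
  by (simp_all add: mat2_def)

lemma mat2_eta: "mat2 (\<gamma>$1$1) (\<gamma>$1$2) (\<gamma>$2$1) (\<gamma>$2$2) = \<gamma>"
  by (simp add: vec_eq_iff forall_2)

lemma matrix_mult_nth_2 [simp]:
  fixes \<alpha> \<beta> :: "int^2^2"
  shows "(\<alpha> ** \<beta>) $ i $ j = \<alpha>$i$1 * \<beta>$1$j + \<alpha>$i$2 * \<beta>$2$j"
  by (simp add: matrix_matrix_mult_def sum_2)

lemma mat2_mult: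
  "mat2 a b c d ** mat2 a' b' c' d' =
     mat2 (a * a' + b * c') (a * b' + b * d') (c * a' + d * c') (c * b' + d * d')"
  by (simp add: vec_eq_iff forall_2)

lemma det_mat2 [simp]: "det (mat2 a b c d) = a * d - b * c"
  by (simp add: det_2)

lemma SL2Z_mult: "\<alpha> \<in> SL2Z \<Longrightarrow> \<beta> \<in> SL2Z \<Longrightarrow> \<alpha> ** \<beta> \<in> SL2Z"
  by (simp add: SL2Z_def det_mul)

lemma SL2Z_det: "\<gamma> \<in> SL2Z \<Longrightarrow> \<gamma>$1$1 * \<gamma>$2$2 - \<gamma>$1$2 * \<gamma>$2$1 = 1"
  by (simp add: SL2Z_def det_2)

lemma SL2Z_coprime_column:
  assumes "\<gamma> \<in> SL2Z" shows "coprime (\<gamma>$1$1) (\<gamma>$2$1)"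
proof (rule coprimeI)
  fix d assume "d dvd \<gamma>$1$1" "d dvd \<gamma>$2$1"
  then have "d dvd \<gamma>$1$1 * \<gamma>$2$2 - \<gamma>$1$2 * \<gamma>$2$1" by simp
  then show "is_unit d" using SL2Z_det[OF assms] by simp
qed

lemma SL2Z_coprime_row:
  assumes "\<gamma> \<in> SL2Z" shows "coprime (\<gamma>$2$1) (\<gamma>$2$2)"
proof (rule coprimeI)
  fix d assume "d dvd \<gamma>$2$1" "d dvd \<gamma>$2$2"
  then have "d dvd \<gamma>$1$1 * \<gamma>$2$2 - \<gamma>$1$2 * \<gamma>$2$1" by simp
  then show "is_unit d" using SL2Z_det[OF assms] by simp
qed

text \<open>Euclidean algorithm on the first column: powers of \<open>T\<close> and the matrix
  \<open>S\<close> on the left shrink the lower left entry to 0. Closure under products stands in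
  for words in generators; the identity and its negative are \<open>T T^-1\<close> and
  \<open>S S\<close>.\<close>

lemma SL2Z_induct [consumes 1, case_names S T T_inv mult]:
  assumes "\<gamma> \<in> SL2Z"
    and S: "P (mat2 0 (-1) 1 0)" and T: "P (mat2 1 1 0 1)" and T_inv: "P (mat2 1 (-1) 0 1)"
    and mult: "\<And>\<alpha> \<beta>. \<lbrakk>\<alpha> \<in> SL2Z; \<beta> \<in> SL2Z; P \<alpha>; P \<beta>\<rbrakk> \<Longrightarrow> P (\<alpha> ** \<beta>)"
  shows "P \<gamma>"
proof -
  have mult': "P (mat2 (a * a' + b * c') (a * b' + b * d') (c * a' + d * c') (c * b' + d * d'))"
    if "P (mat2 a b c d)" "P (mat2 a' b' c' d')" "a * d - b * c = 1" "a' * d' - b' * c' = 1"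
    for a b c d a' b' c' d'
    using mult[of "mat2 a b c d" "mat2 a' b' c' d'"] that by (simp add: SL2Z_def mat2_mult)
  have one: "P (mat2 1 0 0 1)" using mult'[OF T T_inv] by simp
  have neg: "P (mat2 (-1) 0 0 (-1))" using mult'[OF S S] by simp
  have pos: "P (mat2 1 (int n) 0 1)" for n
  proof (induction n)
    case (Suc n) then show ?case using mult'[OF Suc T] by (simp add: add.commute)
  qed (use one in simp)
  have negp: "P (mat2 1 (- int n) 0 1)" for n
  proof (induction n)
    case (Suc n) then show ?case using mult'[OF Suc T_inv] by (simp add: algebra_simps)
  qed (use one in simp)
  have trans: "P (mat2 1 k 0 1)" for k
    using pos negp by (cases k rule: int_cases2) auto
  have "P (mat2 a b c d)" if "a * d - b * c = 1" for a b c d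
    using that
  proof (induction "nat \<bar>c\<bar>" arbitrary: a b c d rule: less_induct)
    case less
    show ?case
    proof (cases "c = 0")
      case True
      then have "a * d = 1" using less.prems by simp
      then have "a = 1 \<and> d = 1 \<or> a = -1 \<and> d = -1" using zmult_eq_1_iff by blast
      then show ?thesis
        using trans[of b] mult'[OF neg trans[of "-b"]] True by auto
    next
      case False
      \<comment> \<open>Factor the matrix as \<open>T^q S\<close> times the one in
        \<open>IH\<close>: \<open>T^-q\<close> turns \<open>a\<close> into \<open>a mod c\<close>,
        and undoing \<open>S\<close> moves this remainder, negated, to the lower left, where it is
        smaller than \<open>c\<close> in absolute value.\<close>
      define q where "q = a div c"
      have r: "a - q * c = a mod c" by (simp add: q_def minus_div_mult_eq_mod)
      have "\<bar>- (a - q * c)\<bar> < \<bar>c\<bar>"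
        unfolding r abs_minus using False by (rule abs_mod_less)
      then have IH: "P (mat2 c d (- (a - q * c)) (- (b - q * d)))"
        using less.prems by (intro less.hyps) (auto simp: algebra_simps)
      have "P (mat2 (a - q * c) (b - q * d) c d)"
        using mult'[OF S IH] less.prems by (simp add: algebra_simps)
      from mult'[OF trans[of q] this] show ?thesis
        using less.prems by (simp add: algebra_simps)
    qed
  qed
  from this[of "\<gamma>$1$1" "\<gamma>$2$2" "\<gamma>$1$2" "\<gamma>$2$1"] show ?thesis
    using SL2Z_det[OF assms(1)] by (simp add: mat2_eta)
qed

section \<open>The action on the upper half plane and the cocycle law\<close>

definition moebius :: "int^2^2 \<Rightarrow> complex \<Rightarrow> complex" where
  "moebius \<beta> z =
     (of_int (\<beta>$1$1) * z + of_int (\<beta>$1$2)) / (of_int (\<beta>$2$1) * z + of_int (\<beta>$2$2))"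

lemma moebius_denom_nonzero:
  fixes \<beta> :: "int^2^2"
  assumes "det \<beta> > 0" "z \<in> uhp"
  shows "of_int (\<beta>$2$1) * z + of_int (\<beta>$2$2) \<noteq> (0::complex)"
proof
  assume *: "of_int (\<beta>$2$1) * z + of_int (\<beta>$2$2) = (0::complex)"
  then have "Im (of_int (\<beta>$2$1) * z + of_int (\<beta>$2$2)) = 0" by simp
  then have "\<beta>$2$1 = 0" using assms(2) by (auto simp: uhp_def)
  with * assms(1) show False by (auto simp: det_2)
qed

lemma moebius_in_uhp:
  assumes "det \<beta> > 0" "z \<in> uhp"
  shows "moebius \<beta> z \<in> uhp"
proof -
  let ?n = "of_int (\<beta>$1$1) * z + of_int (\<beta>$1$2) :: complex"
  let ?d = "of_int (\<beta>$2$1) * z + of_int (\<beta>$2$2) :: complex"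
  have "Im ?n * Re ?d - Re ?n * Im ?d = of_int (det \<beta>) * Im z"
    by (simp add: det_2 algebra_simps)
  then have "Im ?n * Re ?d - Re ?n * Im ?d > 0"
    using assms by (simp add: uhp_def)
  moreover have "(Re ?d)\<^sup>2 + (Im ?d)\<^sup>2 > 0"
    using moebius_denom_nonzero[OF assms] by (simp add: complex_neq_0)
  ultimately show ?thesis
    unfolding uhp_def moebius_def mem_Collect_eq Im_divide by (rule divide_pos_pos)
qed

lemma slash_eq:
  "z \<in> uhp \<Longrightarrow> slash f \<beta> z = f (moebius \<beta> z) / (of_int (\<beta>$2$1) * z + of_int (\<beta>$2$2))"
  by (simp add: slash_def moebius_def)

lemma slash_slash:
  assumes "det \<beta> > 0"
  shows "slash (slash f \<alpha>) \<beta> = slash f (\<alpha> ** \<beta>)"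
proof
  fix z
  show "slash (slash f \<alpha>) \<beta> z = slash f (\<alpha> ** \<beta>) z"
  proof (cases "z \<in> uhp")
    case True
    let ?n = "of_int (\<beta>$1$1) * z + of_int (\<beta>$1$2) :: complex"
    let ?d = "of_int (\<beta>$2$1) * z + of_int (\<beta>$2$2) :: complex"
    have d: "?d \<noteq> 0" using moebius_denom_nonzero[OF assms True] .
    \<comment> \<open>Multiplying by the denominator of \<open>moebius \<beta> z\<close> clears the
      inner fraction. Taking \<open>(x, y)\<close> to be the rows of \<open>\<alpha>\<close> yields
      both the composition law and the cocycle law of the denominators.\<close>
    have prod: "(of_int x * moebius \<beta> z + of_int y) * ?d =
        of_int (x * \<beta>$1$1 + y * \<beta>$2$1) * z + of_int (x * \<beta>$1$2 + y * \<beta>$2$2)" for x y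
    proof -
      have "moebius \<beta> z * ?d = ?n" using d by (simp add: moebius_def)
      then have "(of_int x * moebius \<beta> z + of_int y) * ?d = of_int x * ?n + of_int y * ?d"
        by (simp only: distrib_right[of "_ * moebius \<beta> z"] mult.assoc)
      then show ?thesis by (simp only:) (simp add: algebra_simps)
    qed
    have "moebius \<alpha> (moebius \<beta> z) =
        ((of_int (\<alpha>$1$1) * moebius \<beta> z + of_int (\<alpha>$1$2)) * ?d) /
        ((of_int (\<alpha>$2$1) * moebius \<beta> z + of_int (\<alpha>$2$2)) * ?d)"
      using d by (simp add: moebius_def)
    also have "\<dots> = moebius (\<alpha> ** \<beta>) z"
      unfolding prod by (simp add: moebius_def)
    finally have "moebius \<alpha> (moebius \<beta> z) = moebius (\<alpha> ** \<beta>) z" .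
    moreover have "slash (slash f \<alpha>) \<beta> z = f (moebius \<alpha> (moebius \<beta> z)) /
        ((of_int (\<alpha>$2$1) * moebius \<beta> z + of_int (\<alpha>$2$2)) * ?d)"
      using True moebius_in_uhp[OF assms True] by (simp only: slash_eq divide_divide_eq_left)
    ultimately show ?thesis
      unfolding prod slash_eq[OF True] matrix_mult_nth_2 by (simp only:)
  qed (simp add: slash_def)
qed

lemma slash_add: "slash (\<lambda>z. f z + g z) \<alpha> = (\<lambda>z. slash f \<alpha> z + slash g \<alpha> z)"
  by (auto simp: slash_def add_divide_distrib)

lemma slash_cmult: "slash (\<lambda>z. k * f z) \<alpha> = (\<lambda>z. k * slash f \<alpha> z)"
  by (auto simp: slash_def)

lemma slash_uminus_matrix: "slash f (mat2 (-a) (-b) (-c) (-d)) z = - slash f (mat2 a b c d) z"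
proof -
  define n m where "n = of_int a * z + of_int b" and "m = of_int c * z + of_int d"
  have "of_int (- a) * z + of_int (- b) = - n" "of_int (- c) * z + of_int (- d) = - m"
    by (simp_all add: n_def m_def)
  then show ?thesis
    unfolding slash_def mat2_nth n_def[symmetric] m_def[symmetric] by (simp only:) simp
qed

section \<open>Expansions at infinity\<close>

text \<open>A logarithm of \<open>w\<close> gives \<open>z\<close>; its imaginary part is positive
  because \<open>ln (norm w) < 0\<close>. Thus a q-expansion is a power series on the whole
  punctured disc.\<close>

lemma exp_surj_punctured_disc:
  assumes "h > 0" "w \<noteq> 0" "norm w < 1"
  shows "\<exists>z\<in>uhp. exp (2 * of_real pi * \<i> * z / of_nat h) = w"
proof -
  define z where "z = ln w * of_nat h / (2 * of_real pi * \<i>)"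
  have "Im (- \<i> * u * of_real c) = - Re u * c" for u c by simp
  moreover have "z = - \<i> * ln w * of_real (real h / (2 * pi))"
    by (simp add: z_def divide_simps)
  moreover have "Re (ln w) = ln (norm w)" using assms by simp
  ultimately have "Im z = - ln (norm w) * (real h / (2 * pi))" by (simp only:)
  moreover have "ln (norm w) < 0" using assms by simp
  ultimately have "Im z > 0" using assms by (simp add: mult_neg_pos divide_neg_pos)
  moreover have "2 * of_real pi * \<i> * z / of_nat h = ln w"
    using assms by (simp add: z_def)
  ultimately show ?thesis using assms by (intro bexI[of _ z]) (simp_all add: uhp_def)
qed

lemma q_power: "exp (2 * of_real pi * \<i> * z * of_nat n / of_nat h)
    = exp (2 * of_real pi * \<i> * z / of_nat h) ^ n"
  by (simp add: exp_of_nat_mult[symmetric] mult_ac)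

text \<open>The constant coefficient is a limit at the centre of the punctured disc.
  \<open>F\<close> fixes one preimage \<open>z\<close> for each \<open>w\<close>, so both expansions
  sum to the same function of \<open>w\<close>.\<close>

lemma has_q_expansion_unique_const:
  assumes "h > 0" "has_q_expansion h g a" "has_q_expansion h g b"
  shows "a 0 = b 0"
proof -
  define F where "F w = g (SOME z. z \<in> uhp \<and> exp (2 * of_real pi * \<i> * z / of_nat h) = w)" for w
  have "(F \<longlongrightarrow> a 0) (at 0)" if "has_q_expansion h g a" for a
  proof (rule powser_limit_0_strong[of 1])
    fix w :: complex assume "w \<noteq> 0" "norm w < 1"
    define z where "z = (SOME z. z \<in> uhp \<and> exp (2 * of_real pi * \<i> * z / of_nat h) = w)"
    have "\<exists>z. z \<in> uhp \<and> exp (2 * of_real pi * \<i> * z / of_nat h) = w"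
      using exp_surj_punctured_disc[OF \<open>h > 0\<close> \<open>w \<noteq> 0\<close> \<open>norm w < 1\<close>] by blast
    from someI_ex[OF this] have z: "z \<in> uhp \<and> exp (2 * of_real pi * \<i> * z / of_nat h) = w"
      by (simp only: z_def)
    then have "(\<lambda>n. a n * exp (2 * of_real pi * \<i> * z / of_nat h) ^ n) sums g z"
      using that unfolding has_q_expansion_def q_power by blast
    moreover have "F w = g z" by (simp only: F_def z_def)
    ultimately show "(\<lambda>n. a n * w ^ n) sums F w" using z by simp
  qed simp
  from LIM_unique[OF this[OF assms(2)] this[OF assms(3)]] show ?thesis .
qed

lemma const_term_eqI:
  assumes "h > 0" "has_q_expansion h g a"
  shows "const_term h g = a 0"
  unfolding const_term_def
proof (rule the_equality)
  show "\<exists>b. has_q_expansion h g b \<and> b 0 = a 0" using assms(2) by blast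
  show "c = a 0" if "\<exists>b. has_q_expansion h g b \<and> b 0 = c" for c
    using that has_q_expansion_unique_const[OF assms(1) _ assms(2)] by blast
qed

lemma has_q_expansion_add:
  assumes "has_q_expansion h f a" "has_q_expansion h g b"
  shows "has_q_expansion h (\<lambda>z. f z + g z) (\<lambda>n. a n + b n)"
  unfolding has_q_expansion_def
proof
  fix z assume z: "z \<in> uhp"
  show "(\<lambda>n. (a n + b n) * exp (2 * of_real pi * \<i> * z * of_nat n / of_nat h)) sums (f z + g z)"
    using sums_add[OF assms[unfolded has_q_expansion_def, THEN bspec, OF z]]
        by (simp only: distrib_right)
qed

lemma has_q_expansion_cmult:
  assumes "has_q_expansion h f a"
  shows "has_q_expansion h (\<lambda>z. k * f z) (\<lambda>n. k * a n)"
  unfolding has_q_expansion_def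
proof
  fix z assume z: "z \<in> uhp"
  show "(\<lambda>n. k * a n * exp (2 * of_real pi * \<i> * z * of_nat n / of_nat h)) sums (k * f z)"
    using sums_mult[OF assms[unfolded has_q_expansion_def, THEN bspec, OF z]] by (simp only: mult.assoc)
qed

text \<open>Substituting \<open>(A z + B) / D\<close> turns \<open>q^(n/h)\<close> into a root of
  unity times \<open>q^(A n / (D h))\<close>, and the hypothesis on \<open>k\<close> rewrites this
  exponent as \<open>k n / h'\<close>. The divisor \<open>D\<close> is the automorphy
  factor.\<close>

lemma has_q_expansion_slash_upper:
  fixes k :: nat
  assumes g: "has_q_expansion h g a" and "k > 0" "h > 0" "h' > 0" "A > 0" "D > 0"
    and k: "int k * D * int h = A * int h'"
  shows "\<exists>b. has_q_expansion h' (slash g (mat2 A B 0 D)) b \<and> b 0 = a 0 / of_int D"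
proof -
  define e where "e x = exp (2 * of_real pi * \<i> * x)" for x :: complex
  \<comment> \<open>\<open>c\<close> absorbs the root of unity and the factor \<open>1 / D\<close>;
    \<open>b\<close> spreads the coefficients \<open>c\<close> over the multiples of
    \<open>k\<close>.\<close>
  define c where "c n = a n * e (of_int B * of_nat n / (of_int D * of_nat h)) / of_int D" for n
  define b where "b n = (if k dvd n then c (n div k) else 0)" for n
  have "(\<lambda>n. b n * e (z * of_nat n / of_nat h')) sums slash g (mat2 A B 0 D) z" if z: "z \<in> uhp" for z
  proof -
    define w where "w = (of_int A * z + of_int B) / (of_int D :: complex)"
    have w: "w \<in> uhp" using moebius_in_uhp[of "mat2 A B 0 D" z] z \<open>A > 0\<close> \<open>D > 0\<close>
      by (simp add: moebius_def w_def)
    have kk: "of_nat k * of_int D * of_nat h = (of_int A * of_nat h' :: complex)"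
      using k by (metis of_int_mult of_int_of_nat_eq)
    have ee: "e (w * of_nat n / of_nat h) =
        e (of_int B * of_nat n / (of_int D * of_nat h)) * e (z * of_nat (k * n) / of_nat h')" for n
    proof -
      have "z * of_nat (k * n) / of_nat h' = of_nat k * (z * of_nat n) / of_nat h'" by simp
      also have "\<dots> = of_int A * (z * of_nat n) / (of_int D * of_nat h)"
        using assms
      proof (subst frac_eq_eq)
        have "of_nat k * (z * of_nat n) * (of_int D * of_nat h) =
            (of_nat k * of_int D * of_nat h) * (z * of_nat n)" by (simp add: mult_ac)
        then show "of_nat k * (z * of_nat n) * (of_int D * of_nat h) =
            of_int A * (z * of_nat n) * of_nat h'" unfolding kk by (simp add: mult_ac)
      qed auto
      finally have zk: "z * of_nat (k * n) / of_nat h' =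
          of_int A * (z * of_nat n) / (of_int D * of_nat h)" .
      have "w * of_nat n / of_nat h =
          of_int B * of_nat n / (of_int D * of_nat h) + z * of_nat (k * n) / of_nat h'"
        unfolding zk using assms by (simp add: w_def field_simps)
      then show ?thesis by (simp add: e_def distrib_left exp_add)
    qed
    have "(\<lambda>n. a n * e (w * of_nat n / of_nat h)) sums g w"
      using g w by (simp add: has_q_expansion_def e_def mult.assoc)
    from sums_divide[OF this, of "of_int D"]
    have "(\<lambda>n. c n * e (z * of_nat (k * n) / of_nat h')) sums (g w / of_int D)"
      by (simp add: ee c_def mult_ac)
    then have "(\<lambda>n. b (k * n) * e (z * of_nat (k * n) / of_nat h')) sums (g w / of_int D)"
      using \<open>k > 0\<close> by (simp add: b_def)
    then have "(\<lambda>n. b n * e (z * of_nat n / of_nat h')) sums (g w / of_int D)"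
    proof (subst (asm) sums_mono_reindex[of "\<lambda>n. k * n"])
      show "strict_mono (\<lambda>n. k * n)" using \<open>k > 0\<close> by (simp add: strict_mono_def)
      show "b n * e (z * of_nat n / of_nat h') = 0" if "n \<notin> range (\<lambda>n. k * n)" for n
        using that by (auto simp: b_def)
    qed
    then show ?thesis using z by (simp add: slash_def w_def)
  qed
  then have "has_q_expansion h' (slash g (mat2 A B 0 D)) b"
    by (simp add: has_q_expansion_def e_def mult.assoc)
  moreover have "b 0 = a 0 / of_int D" by (simp add: b_def c_def e_def)
  ultimately show ?thesis by blast
qed

section \<open>Lambert series for the theta squares\<close>

text \<open>The denominator is at least \<open>1 - r\<close> in modulus, as
  \<open>r ^ (2 * m) \<le> r\<close> for \<open>m > 0\<close>. This supplies the majorant for the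
  Weierstrass test.\<close>

lemma lambert_term_bound:
  fixes Q :: complex
  assumes "norm Q \<le> r" "r < 1" "m > 0"
  shows "norm (Q ^ m / (1 + Q ^ (2 * m))) \<le> r ^ m / (1 - r)"
proof -
  have r: "0 \<le> r" using assms(1) norm_ge_zero order_trans by blast
  have "norm (Q ^ (2 * m)) \<le> r ^ (2 * m)"
    unfolding norm_power using assms by (intro power_mono) auto
  also have "\<dots> \<le> r"
    using r assms power_decreasing[of 1 "2 * m" r] by simp
  finally have "1 - r \<le> 1 - norm (Q ^ (2 * m))" by simp
  also have "\<dots> \<le> norm (1 + Q ^ (2 * m))"
    using norm_diff_ineq[of 1 "Q ^ (2 * m)"] by simp
  finally have "1 - r \<le> norm (1 + Q ^ (2 * m))" .
  moreover have "norm (Q ^ m) \<le> r ^ m"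
    unfolding norm_power using assms by (intro power_mono) auto
  ultimately show ?thesis
    unfolding norm_divide using assms r by (intro frac_le) auto
qed

lemma lambert_denom_nonzero:
  fixes Q :: complex
  assumes "norm Q < 1" "m > 0"
  shows "1 + Q ^ m \<noteq> 0"
proof
  assume "1 + Q ^ m = 0"
  then have "Q ^ m = - 1" by (simp add: add_eq_0_iff)
  then have "norm (Q ^ m) = 1" by simp
  moreover have "norm (Q ^ m) < 1" using assms by (simp add: norm_power power_less_one_iff)
  ultimately show False by simp
qed

text \<open>Weierstrass test on small balls: since \<open>s n > n\<close>, the terms are dominated
  by the geometric series \<open>r ^ n / (1 - r)\<close>. The weights \<open>e\<close> allow for
  alternating signs.\<close>

lemma lambert_series:
  fixes s :: "nat \<Rightarrow> nat" and e :: "nat \<Rightarrow> complex"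
  assumes s: "\<And>n. n < s n" and e: "\<And>n. norm (e n) \<le> 1"
  defines "F \<equiv> \<lambda>Q. \<Sum>n. e n * (Q ^ s n / (1 + Q ^ (2 * s n)))"
  shows "F holomorphic_on ball 0 1"
    and "norm Q < 1 \<Longrightarrow> (\<lambda>n. e n * (Q ^ s n / (1 + Q ^ (2 * s n)))) sums F Q"
proof -
  let ?f = "\<lambda>n Q. e n * (Q ^ s n / (1 + Q ^ (2 * s n)))"
  have s0: "s n > 0" for n using s[of n] by simp
  have "\<exists>g. \<forall>x\<in>ball 0 1. (\<lambda>n. ?f n x) sums g x \<and> g field_differentiable (at x)"
  proof (rule series_differentiable_comparison_complex[of "ball 0 1" ?f])
    show "?f n field_differentiable (at x)" if "x \<in> ball 0 1" for n x
      using lambert_denom_nonzero[of x "2 * s n"] s0 that by (intro derivative_intros) auto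
    show "\<exists>d h. 0 < d \<and> summable h \<and> range h \<subseteq> \<real>\<^sub>\<ge>\<^sub>0 \<and>
        (\<forall>\<^sub>F n in sequentially. \<forall>y\<in>ball x d \<inter> ball 0 1. norm (?f n y) \<le> cmod (h n))"
      if "x \<in> ball 0 1" for x :: complex
    proof -
      define r where "r = (1 + norm x) / 2"
      have r: "norm x < r" "r < 1" "0 < r" using that norm_ge_zero[of x]
          by (auto simp: r_def simp del: norm_ge_zero)
      have "norm (?f n y) \<le> norm (of_real (r ^ n / (1 - r)) :: complex)"
        if "y \<in> ball x (r - norm x)" for n y
      proof -
        have "norm y \<le> norm x + norm (y - x)" by (metis add.commute diff_add_cancel norm_triangle_ineq)
        also have "\<dots> \<le> r" using that by (simp add: dist_norm norm_minus_commute)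
        finally have "norm (y ^ s n / (1 + y ^ (2 * s n))) \<le> r ^ s n / (1 - r)"
          using r s0 by (intro lambert_term_bound) auto
        also have "\<dots> \<le> r ^ n / (1 - r)"
          using r s[of n] by (intro divide_right_mono power_decreasing) auto
        finally have *: "norm (y ^ s n / (1 + y ^ (2 * s n))) \<le> r ^ n / (1 - r)" .
        have "norm (?f n y) \<le> 1 * (r ^ n / (1 - r))"
          unfolding norm_mult by (intro mult_mono * e) auto
        also have "\<dots> = norm (of_real (r ^ n / (1 - r)) :: complex)"
          using r by (subst norm_of_real) simp
        finally show ?thesis .
      qed
      moreover have "summable (\<lambda>n. of_real (r ^ n / (1 - r)) :: complex)"
        using r by (intro summable_of_real summable_divide summable_geometric) simp
      moreover have "range (\<lambda>n. of_real (r ^ n / (1 - r)) :: complex) \<subseteq> \<real>\<^sub>\<ge>\<^sub>0"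
        using r by (auto simp: nonneg_Reals_of_real_iff simp del: of_real_divide of_real_power)
      ultimately show ?thesis
        using r by (intro exI[of _ "r - norm x"] exI[of _ "\<lambda>n. of_real (r ^ n / (1 - r)) :: complex"]
            conjI always_eventually allI ballI) simp_all
    qed
  qed auto
  then obtain g where g: "\<And>x. x \<in> ball 0 1 \<Longrightarrow> (\<lambda>n. ?f n x) sums g x"
    "\<And>x. x \<in> ball 0 1 \<Longrightarrow> g field_differentiable (at x)" by blast
  have Fg: "F x = g x" if "x \<in> ball 0 1" for x using g(1)[OF that] by (simp add: F_def sums_iff)
  have "g holomorphic_on ball 0 1"
    using g(2) by (auto simp: holomorphic_on_def intro: field_differentiable_at_within)
  then show "F holomorphic_on ball 0 1" by (rule holomorphic_transform) (simp add: Fg)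
  show "(\<lambda>n. ?f n Q) sums F Q" if "norm Q < 1" using g(1)[of Q] Fg[of Q] that by simp
qed

text \<open>
  The squares of Jacobi's theta constants \<open>\<theta>\<^sub>2\<close>, \<open>\<theta>\<^sub>3\<close>, \<open>\<theta>\<^sub>4\<close> (classical arguments, nome
  \<open>exp (\<pi>iz) = Q\<^sup>2\<close>) as Lambert series in \<open>Q = q\<^sup>1\<^sup>/\<^sup>4\<close>. They span the same space as \<open>M\<close>, \<open>N\<close>, \<open>P\<close>,
  but \<open>SL(2,\<int>)\<close> permutes them up to scalars.
\<close>

definition theta2_disc :: "complex \<Rightarrow> complex" where
  "theta2_disc Q = 4 * (\<Sum>n. Q ^ (2*n+1) / (1 + Q ^ (2 * (2*n+1))))"

definition theta3_disc :: "complex \<Rightarrow> complex" where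
  "theta3_disc Q = 1 + 4 * (\<Sum>n. Q ^ (2*(n+1)) / (1 + Q ^ (2 * (2*(n+1)))))"

definition theta4_disc :: "complex \<Rightarrow> complex" where
  "theta4_disc Q = 1 + 4 * (\<Sum>n. (-1) ^ (n+1) * (Q ^ (2*(n+1)) / (1 + Q ^ (2 * (2*(n+1))))))"

lemma theta2_disc_holo: "theta2_disc holomorphic_on ball 0 1"
  unfolding theta2_disc_def using lambert_series(1)[of "\<lambda>n. 2*n+1" "\<lambda>_. 1"]
  by (intro holomorphic_intros) simp

lemma theta3_disc_holo: "theta3_disc holomorphic_on ball 0 1"
  unfolding theta3_disc_def using lambert_series(1)[of "\<lambda>n. 2*(n+1)" "\<lambda>_. 1"]
  by (intro holomorphic_intros) simp

lemma theta4_disc_holo: "theta4_disc holomorphic_on ball 0 1"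
  unfolding theta4_disc_def by (intro holomorphic_intros lambert_series) (auto simp: norm_power)

lemma theta234_disc_0: "theta2_disc 0 = 0" "theta3_disc 0 = 1" "theta4_disc 0 = 1"
  by (simp_all add: theta2_disc_def theta3_disc_def theta4_disc_def)

lemma i_power_even: "(\<i> * Q) ^ (2 * m) = (-1) ^ m * Q ^ (2 * m)"
proof -
  have "(\<i> * Q) ^ (2 * m) = (-1 * Q\<^sup>2) ^ m"
    unfolding power_mult by (simp add: power_mult_distrib)
  also have "\<dots> = (-1) ^ m * Q ^ (2 * m)" by (simp only: power_mult_distrib power_mult)
  finally show ?thesis .
qed

text \<open>As \<open>Q = q^(1/4)\<close>, multiplying \<open>Q\<close> by \<open>\<i>\<close> is
  the translation \<open>z \<mapsto> z + 1\<close>.\<close>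

lemma theta3_disc_i: "theta3_disc (\<i> * Q) = theta4_disc Q"
proof -
  have "(\<i> * Q) ^ (2*(n+1)) / (1 + (\<i> * Q) ^ (2 * (2*(n+1)))) =
      (-1) ^ (n+1) * (Q ^ (2*(n+1)) / (1 + Q ^ (2 * (2*(n+1)))))" for n
    unfolding i_power_even by simp
  then show ?thesis unfolding theta3_disc_def theta4_disc_def by (simp only:)
qed

lemma theta4_disc_i: "theta4_disc (\<i> * Q) = theta3_disc Q"
proof -
  have "theta4_disc (\<i> * Q) = theta3_disc (\<i> * (\<i> * Q))" by (rule theta3_disc_i[symmetric])
  also have "\<i> * (\<i> * Q) = - Q" by simp
  also have "theta3_disc (- Q) = theta3_disc Q" by (simp add: theta3_disc_def)
  finally show ?thesis .
qed

text \<open>The two iterated sums of \<open>(-1) ^ n * x ^ ((2n+1) (2m+1))\<close>.\<close>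

lemma lambert_swap:
  fixes x :: complex
  assumes x: "norm x < 1"
  shows "(\<Sum>n. (-1) ^ n * (x ^ (2*n+1) / (1 - x ^ (2 * (2*n+1))))) =
         (\<Sum>n. x ^ (2*n+1) / (1 + x ^ (2 * (2*n+1))))"
    and "summable (\<lambda>n. (-1) ^ n * (x ^ (2*n+1) / (1 - x ^ (2 * (2*n+1)))))"
proof -
  define f where "f = (\<lambda>(n, m). (-1) ^ n * x ^ ((2*n+1) * (2*m+1)))"
  define L where "L n = (-1) ^ n * (x ^ (2*n+1) / (1 - x ^ (2 * (2*n+1))))" for n
  define R where "R n = x ^ (2*n+1) / (1 + x ^ (2 * (2*n+1)))" for n
  have geo: "((\<lambda>k. y * q ^ k) has_sum (y / (1 - q))) UNIV" if "norm q < 1"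
    for q y :: "'a :: {real_normed_field, banach}"
  proof -
    have "(\<lambda>k. y * q ^ k) sums (y * (1 / (1 - q)))" using that by (intro sums_mult geometric_sums)
    moreover have "summable (\<lambda>k. norm (y * q ^ k))"
      using that by (simp add: norm_mult norm_power summable_mult summable_geometric)
    ultimately show ?thesis using norm_summable_imp_has_sum by fastforce
  qed
  \<comment> \<open>A product of two geometric series dominates the double series, because
    \<open>(2n+1)(2m+1) \<ge> n + m\<close>.\<close>
  have "(\<lambda>(n, m). norm x ^ n * norm x ^ m) summable_on (UNIV \<times> UNIV :: (nat \<times> nat) set)"
  proof (rule summable_on_SigmaI)
    show "((\<lambda>m. case (n, m) of (n, m) \<Rightarrow> norm x ^ n * norm x ^ m) has_sum
        norm x ^ n / (1 - norm x)) UNIV" for n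
      using geo[of "norm x" "norm x ^ n"] x by simp
    show "(\<lambda>n. norm x ^ n / (1 - norm x)) summable_on UNIV"
      using geo[of "norm x" "1 / (1 - norm x)"] x by (auto simp: summable_on_def)
  qed auto
  then have "(\<lambda>p. norm (f p)) summable_on UNIV \<times> UNIV"
  proof (rule Infinite_Sum.abs_summable_on_comparison_test')
    fix p :: "nat \<times> nat"
    obtain n m where p: "p = (n, m)" by (cases p)
    have "norm (f p) = norm x ^ ((2*n+1) * (2*m+1))" by (simp add: f_def p norm_mult norm_power)
    also have "\<dots> \<le> norm x ^ (n + m)" using x by (intro power_decreasing) auto
    finally show "norm (f p) \<le> (case p of (n, m) \<Rightarrow> norm x ^ n * norm x ^ m)"
      by (simp add: p power_add)
  qed
  then have f: "f summable_on UNIV \<times> UNIV" by (rule Infinite_Sum.abs_summable_summable)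
  have pw: "norm (x ^ (2 * (2*n+1))) < 1" for n
    using x by (simp add: norm_power power_less_one_iff del: power_Suc)
  have row: "((\<lambda>m. f (n, m)) has_sum L n) UNIV" for n
  proof -
    have "f (n, m) = ((-1) ^ n * x ^ (2*n+1)) * (x ^ (2 * (2*n+1))) ^ m" for m
      by (simp add: f_def power_mult[symmetric] power_add[symmetric] algebra_simps del: power_Suc)
    then show ?thesis using geo[OF pw[of n], of "(-1) ^ n * x ^ (2*n+1)"] by (simp add: L_def)
  qed
  have col: "((\<lambda>n. f (n, m)) has_sum R m) UNIV" for m
  proof -
    have "f (n, m) = x ^ (2*m+1) * (- (x ^ (2 * (2*m+1)))) ^ n" for n
    proof -
      have "(- (x ^ (2 * (2*m+1)))) ^ n = (-1) ^ n * x ^ (2 * (2*m+1) * n)"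
        by (subst power_minus) (simp only: power_mult)
      then show ?thesis by (simp add: f_def power_add[symmetric] algebra_simps del: power_Suc)
    qed
    moreover have "norm (- (x ^ (2 * (2*m+1)))) < 1" using pw[of m] by simp
    ultimately show ?thesis using geo[of "- (x ^ (2 * (2*m+1)))" "x ^ (2*m+1)"] by (simp add: R_def)
  qed
  have fs: "(f has_sum infsum f (UNIV \<times> UNIV)) (UNIV \<times> UNIV)" using f by simp
  have L: "(L has_sum infsum f (UNIV \<times> UNIV)) UNIV"
    by (rule has_sum_SigmaD[OF fs]) (use row in simp)
  have "((\<lambda>(m, n). f (n, m)) has_sum infsum f (UNIV \<times> UNIV)) (UNIV \<times> UNIV)"
    using fs by (subst has_sum_swap[symmetric]) simp
  then have R: "(R has_sum infsum f (UNIV \<times> UNIV)) UNIV"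
    by (rule has_sum_SigmaD) (use col in simp)
  from has_sum_imp_sums[OF L] has_sum_imp_sums[OF R] show
    "(\<Sum>n. (-1) ^ n * (x ^ (2*n+1) / (1 - x ^ (2 * (2*n+1))))) =
         (\<Sum>n. x ^ (2*n+1) / (1 + x ^ (2 * (2*n+1))))"
    "summable (\<lambda>n. (-1) ^ n * (x ^ (2*n+1) / (1 - x ^ (2 * (2*n+1)))))"
    unfolding L_def R_def by (auto simp: sums_iff)
qed

text \<open>Rotating \<open>Q\<close> makes the series alternate and flips the sign in its
  denominators; \<open>lambert_swap\<close> converts it back to the original shape.\<close>

lemma theta2_disc_i:
  assumes "norm Q < 1"
  shows "theta2_disc (\<i> * Q) = \<i> * theta2_disc Q"
proof -
  have "(\<i> * Q) ^ (2*n+1) / (1 + (\<i> * Q) ^ (2 * (2*n+1))) =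
      \<i> * ((-1) ^ n * (Q ^ (2*n+1) / (1 - Q ^ (2 * (2*n+1)))))" for n
  proof -
    have "(\<i> * Q) ^ (2*n+1) = \<i> * (-1) ^ n * Q ^ (2*n+1)"
      using i_power_even[of Q n] by (simp add: mult_ac)
    moreover have "(\<i> * Q) ^ (2 * (2*n+1)) = - (Q ^ (2 * (2*n+1)))"
      unfolding i_power_even by simp
    ultimately show ?thesis by simp
  qed
  then have "theta2_disc (\<i> * Q) = 4 * (\<Sum>n. \<i> * ((-1) ^ n * (Q ^ (2*n+1) / (1 - Q ^ (2 * (2*n+1))))))"
    by (simp add: theta2_disc_def)
  also have "\<dots> = \<i> * theta2_disc Q"
    by (subst suminf_mult[OF lambert_swap(2)[OF assms]], subst lambert_swap(1)[OF assms]) (simp add: theta2_disc_def)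
  finally show ?thesis .
qed

section \<open>The inversion formula\<close>

text \<open>This and the next three bounds control the two factors of the kernel on the contour:
  \<open>sinh\<close> gives the growth of one factor, while on suitable vertical lines the other
  stays away from 0.\<close>

lemma norm_cos_ge_sinh: "norm (cos z) \<ge> \<bar>sinh (Im z)\<bar>"
proof -
  have "(norm (cos z))\<^sup>2 \<ge> \<bar>sinh (Im z)\<bar>\<^sup>2"
    by (simp add: norm_cos_squared sinh_def exp_minus power_divide)
  then show ?thesis by (rule power2_le_imp_le) simp
qed

lemma norm_sin_ge_sinh: "norm (sin z) \<ge> \<bar>sinh (Im z)\<bar>"
proof -
  have "(exp (Im z))\<^sup>2 = exp (2 * Im z)" by (simp add: exp_double)
  then have "\<bar>sinh (Im z)\<bar>\<^sup>2 = (exp (2 * Im z) + inverse (exp (2 * Im z)) - 2) / 4"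
    by (simp add: sinh_def exp_minus power_divide power2_diff power_inverse)
  also have "\<dots> \<le> (norm (sin z))\<^sup>2"
    using cos_le_one[of "2 * Re z"] by (simp add: norm_sin_squared)
  finally show ?thesis by (rule power2_le_imp_le) simp
qed

lemma norm_cos_ge_1: "(cos (Re z))\<^sup>2 = 1 \<Longrightarrow> norm (cos z) \<ge> 1"
proof -
  assume "(cos (Re z))\<^sup>2 = 1"
  then have "1\<^sup>2 \<le> (norm (cos z))\<^sup>2" by (simp add: norm_cos_squared)
  then show ?thesis by (rule power2_le_imp_le) simp
qed

text \<open>The hypothesis puts \<open>Re z\<close> at an odd multiple of \<open>pi / 2\<close>,
  where the modulus of the sine is \<open>cosh (Im z)\<close>.\<close>

lemma norm_sin_ge_1: "cos (2 * Re z) = -1 \<Longrightarrow> norm (sin z) \<ge> 1"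
proof -
  assume *: "cos (2 * Re z) = -1"
  have "exp (2 * Im z) + inverse (exp (2 * Im z)) \<ge> 2"
    using cosh_real_ge_1[of "2 * Im z"] by (simp add: cosh_def exp_minus)
  with * have "1\<^sup>2 \<le> (norm (sin z))\<^sup>2" by (simp add: norm_sin_squared)
  then show ?thesis by (rule power2_le_imp_le) simp
qed

lemma sum_even_int:
  fixes f :: "int \<Rightarrow> complex"
  assumes "\<And>k. f (- k) = f k"
  shows "(\<Sum>k\<in>{- int N..int N}. f k) = f 0 + 2 * (\<Sum>n<N. f (int n + 1))"
proof (induction N)
  case (Suc N)
  have "{- int (Suc N)..int (Suc N)} = insert (int N + 1) (insert (- (int N + 1)) {- int N..int N})"
    by auto
  then show ?case using Suc by (simp add: assms del: minus_add_distrib)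
qed simp

lemma sum_reflected_int:
  fixes f :: "int \<Rightarrow> complex"
  assumes "\<And>k. f (- 1 - k) = f k"
  shows "(\<Sum>k\<in>{- int N..<int N}. f k) = 2 * (\<Sum>n<N. f (int n))"
proof (induction N)
  case (Suc N)
  have "{- int (Suc N)..<int (Suc N)} = insert (int N) (insert (- 1 - int N) {- int N..<int N})"
    by auto
  then show ?case using Suc by (simp add: assms)
qed simp

section \<open>Residues of the kernel \<open>pi / (sin (pi w) cosh (pi t w))\<close>, with
  \<open>cosh x\<close> written as \<open>cos (\<i> * x)\<close>\<close>

context
  fixes t :: real and D G :: "complex \<Rightarrow> complex"
  assumes t: "t > 0"
  defines "D \<equiv> (\<lambda>w. sin (of_real pi * w) * cos (\<i> * of_real (pi * t) * w))"
  defines "G \<equiv> (\<lambda>w. of_real pi / D w)"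
begin

text \<open>The zeros of \<open>cosh (pi t w)\<close>: the second row of poles, on the imaginary
  axis.\<close>

definition imag_pole :: "int \<Rightarrow> complex" where "imag_pole k = \<i> * of_real ((of_int k + 1/2) / t)"

lemma D_zeros:
  assumes "D w = 0"
  shows "(\<exists>k. w = of_int k) \<or> (\<exists>k. w = \<i> * of_real ((of_int k + 1/2) / t))"
proof -
  from assms consider "sin (of_real pi * w) = 0" | "cos (\<i> * of_real (pi * t) * w) = 0"
    by (auto simp: D_def)
  then show ?thesis
  proof cases
    case 1
    then obtain n :: int where "of_real pi * w = of_real (n * pi)" using sin_eq_0 by blast
    then have "w = of_int n" by simp
    then show ?thesis by blast
  next
    case 2
    then obtain n :: int where "\<i> * of_real (pi * t) * w = of_real (n * pi) + of_real pi / 2"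
      using cos_eq_0 by blast
    then have "of_real pi * (\<i> * of_real t * w) = of_real pi * (of_int n + 1 / 2)"
      by (simp add: algebra_simps)
    then have "\<i> * of_real t * w = of_int n + 1 / 2" by simp
    \<comment> \<open>Dividing by \<open>\<i>\<close> changes the sign, and
      \<open>-(n + 1/2) = (-n-1) + 1/2\<close> shifts the index.\<close>
    then have "w = \<i> * of_real ((of_int (-n-1) + 1/2) / t)"
      using t by (auto simp: field_simps complex_eq_iff)
    then show ?thesis by blast
  qed
qed

lemma D_deriv: "(D has_field_derivative
     (of_real pi * cos (of_real pi * w) * cos (\<i> * of_real (pi * t) * w) -
      \<i> * of_real (pi * t) * sin (of_real pi * w) * sin (\<i> * of_real (pi * t) * w))) (at w)"
  unfolding D_def by (auto intro!: derivative_eq_intros)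

lemma D_holo: "D holomorphic_on UNIV"
  unfolding D_def by (intro holomorphic_intros)

text \<open>The zero of \<open>D\<close> is simple: the sine vanishes, so only the first summand of
  the derivative in \<open>D_deriv\<close> survives. At \<open>imag_pole k\<close> the cosine
  vanishes instead and the second summand survives.\<close>

lemma residue_G_int:
  "residue G (of_int k) = 1 / (of_real (cos (of_int k * pi)) * cos (\<i> * of_real (pi * t * of_int k)))"
    (is "_ = 1 / ?r")
proof -
  have s: "sin (of_real pi * of_int k) = (0::complex)"
    using sin_of_real[of "pi * of_int k", where ?'a = complex]
        by (simp add: sin_times_pi_eq_0 mult.commute)
  have c: "cos (of_real pi * of_int k) = (of_real (cos (of_int k * pi)) :: complex)"
    using cos_of_real[of "pi * of_int k", where ?'a = complex] by (simp add: mult.commute)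
  have cc: "cos (\<i> * of_real (pi * t) * of_int k) = cos (\<i> * of_real (pi * t * of_int k))"
    by (simp add: mult.assoc)
  have "norm (cos (\<i> * of_real (pi * t * of_int k))) \<ge> 1" by (rule norm_cos_ge_1) simp
  then have nz: "cos (\<i> * of_real (pi * t * of_int k)) \<noteq> 0" by auto
  have nz': "cos (of_int k * pi) \<noteq> 0" using cos_npi_int[of k]
      by (simp add: mult.commute split: if_splits)
  have "residue G (of_int k) = of_real pi / (of_real pi * ?r)"
    unfolding G_def
  proof (rule residue_simple_pole_deriv[OF _ D_holo])
    show "(D has_field_derivative of_real pi * ?r) (at (of_int k))"
      using D_deriv[of "of_int k"] unfolding s c cc by (simp add: mult.assoc)
    show "D (of_int k) = 0" by (simp add: D_def s)
    show "of_real pi * ?r \<noteq> 0" using nz nz' by simp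
  qed auto
  then show ?thesis by simp
qed

lemma residue_G_imag_pole:
  "residue G (imag_pole k) =
     1 / (\<i> * of_real t * sin (\<i> * of_real (pi * (of_int k + 1/2) / t)) * of_real (cos (of_int k * pi)))"
    (is "_ = 1 / ?r")
proof -
  have arg: "\<i> * of_real (pi * t) * imag_pole k = of_real (- (of_int k * pi + pi / 2))"
    using t by (simp add: imag_pole_def field_simps complex_eq_iff)
  have arg': "of_real pi * imag_pole k = \<i> * of_real (pi * (of_int k + 1/2) / t)"
    by (simp add: imag_pole_def)
  have c: "cos (\<i> * of_real (pi * t) * imag_pole k) = 0"
    unfolding arg cos_of_real cos_minus using sin_times_pi_eq_0[of "of_int k"] by (simp add: cos_add)
  have s: "sin (\<i> * of_real (pi * t) * imag_pole k) = - of_real (cos (of_int k * pi))"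
    unfolding arg sin_of_real sin_minus by (simp add: sin_add)
  have "norm (sin (\<i> * of_real (pi * (of_int k + 1/2) / t)))
      \<ge> \<bar>sinh (pi * (of_int k + 1/2) / t)\<bar>"
    using norm_sin_ge_sinh[of "\<i> * of_real (pi * (of_int k + 1/2) / t)"] by simp
  moreover have "real_of_int k + 1/2 \<noteq> 0"
  proof
    assume "real_of_int k + 1/2 = 0"
    then have "real_of_int (2 * k + 1) = 0" by simp
    then have "2 * k + 1 = 0" by (simp only: of_int_eq_0_iff)
    then show False by presburger
  qed
  ultimately have nz: "sin (\<i> * of_real (pi * (of_int k + 1/2) / t)) \<noteq> 0"
    using t by (auto simp del: of_real_add of_real_mult of_real_divide)
  have nz': "cos (of_int k * pi) \<noteq> 0" using cos_npi_int[of k]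
      by (simp add: mult.commute split: if_splits)
  have "residue G (imag_pole k) = of_real pi / (of_real pi * ?r)"
    unfolding G_def
  proof (rule residue_simple_pole_deriv[OF _ D_holo])
    show "(D has_field_derivative of_real pi * ?r) (at (imag_pole k))"
      using D_deriv[of "imag_pole k"] unfolding s c arg' by (simp add: mult_ac)
    show "D (imag_pole k) = 0" unfolding D_def c by simp
    show "of_real pi * ?r \<noteq> 0" using nz nz' t by simp
  qed auto
  then show ?thesis by simp
qed

text \<open>The sides run halfway between poles: at the half-integers
  \<open>\<plusminus>(N + 1/2)\<close> and at the heights \<open>\<plusminus>N / t\<close>. On
  vertical sides the sine has modulus at least 1 and the hyperbolic factor grows; on horizontal
  sides the roles are exchanged. The range \<open>- N \<le> k < N\<close> is that of the
  \<open>k\<close> with \<open>-N < k + 1/2 < N\<close>.\<close>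

lemma rectangle_identity:
  fixes N :: nat
  assumes N: "N > 0"
  defines "b \<equiv> Complex (real N + 1/2) (real N / t)"
  shows "contour_integral (rectpath (- b) b) G = 2 * pi * \<i> *
      ((\<Sum>k\<in>{- int N..int N}. residue G (of_int k)) + (\<Sum>k\<in>{- int N..<int N}. residue G (imag_pole k)))"
    and "norm (contour_integral (rectpath (- b) b) G) \<le>
      2 * (pi / sinh (pi * t * (real N + 1/2))) * (2 * real N / t) +
      2 * (pi / sinh (pi * real N / t)) * (2 * real N + 1)"
proof -
  have Re_b: "Re b = real N + 1/2" and Im_b: "Im b = real N / t" by (simp_all add: b_def)
  have D_vert: "sinh (pi * t * (real N + 1/2)) \<le> norm (D w)" if "\<bar>Re w\<bar> = real N + 1/2" for w
  proof -
    have "cos (2 * (pi * Re w)) = cos (2 * (pi * \<bar>Re w\<bar>))" by (cases "Re w \<ge> 0") auto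
    also have "\<dots> = cos (real (2 * N + 1) * pi)" unfolding that by (simp add: algebra_simps)
    also have "\<dots> = -1" by (subst cos_npi) simp
    finally have "norm (sin (of_real pi * w)) \<ge> 1" by (intro norm_sin_ge_1) simp
    moreover have "\<bar>sinh (pi * t * Re w)\<bar> = sinh (pi * t * (real N + 1/2))"
      using t by (subst sinh_real_abs[symmetric]) (simp add: abs_mult that)
    then have "norm (cos (\<i> * of_real (pi * t) * w)) \<ge> sinh (pi * t * (real N + 1/2))"
      using norm_cos_ge_sinh[of "\<i> * of_real (pi * t) * w"] by simp
    ultimately have "1 * sinh (pi * t * (real N + 1/2)) \<le>
        norm (sin (of_real pi * w)) * norm (cos (\<i> * of_real (pi * t) * w))"
      using t by (intro mult_mono) auto
    then show ?thesis by (simp add: D_def norm_mult)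
  qed
  have D_hor: "sinh (pi * real N / t) \<le> norm (D w)" if "\<bar>Im w\<bar> = real N / t" for w
  proof -
    have "cos (pi * t * Im w) = cos (pi * t * \<bar>Im w\<bar>)" by (cases "Im w \<ge> 0") auto
    also have "\<dots> = cos (real N * pi)" unfolding that using t by (simp add: field_simps)
    finally have "(cos (pi * t * Im w))\<^sup>2 = 1" by (simp flip: power_mult)
    then have "norm (cos (\<i> * of_real (pi * t) * w)) \<ge> 1" by (intro norm_cos_ge_1) simp
    moreover have "\<bar>sinh (pi * Im w)\<bar> = sinh (pi * real N / t)"
      by (subst sinh_real_abs[symmetric]) (simp add: abs_mult that)
    then have "norm (sin (of_real pi * w)) \<ge> sinh (pi * real N / t)"
      using norm_sin_ge_sinh[of "of_real pi * w"] by simp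
    ultimately have "sinh (pi * real N / t) * 1 \<le>
        norm (sin (of_real pi * w)) * norm (cos (\<i> * of_real (pi * t) * w))"
      using t by (intro mult_mono) auto
    then show ?thesis by (simp add: D_def norm_mult)
  qed
  have pos: "sinh (pi * t * (real N + 1/2)) > 0" "sinh (pi * real N / t) > 0"
    using t N by (auto intro!: mult_pos_pos divide_pos_pos add_pos_pos)
  have path: "\<bar>Re w\<bar> = real N + 1/2 \<or> \<bar>Im w\<bar> = real N / t"
    "\<bar>Re w\<bar> \<le> real N + 1/2" "\<bar>Im w\<bar> \<le> real N / t"
    if "w \<in> path_image (rectpath (- b) b)" for w
    using that N t by (auto simp: path_image_rectpath_cbox_minus_box Re_b Im_b in_cbox_complex_iff
        in_box_complex_iff abs_if split: if_splits)
  have D_path: "D w \<noteq> 0" if "w \<in> path_image (rectpath (- b) b)" for w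
    using path(1)[OF that] D_vert[of w] D_hor[of w] pos by auto
  \<comment> \<open>An open box slightly larger than the contour whose boundary passes through the
    next poles of each row, so that it contains exactly the poles \<open>P1\<close> and
    \<open>P2\<close>.\<close>
  define S where "S = box (- Complex (real N + 1) ((real N + 1/2) / t))
      (Complex (real N + 1) ((real N + 1/2) / t))"
  define P1 where "P1 = (of_int :: int \<Rightarrow> complex) ` {- int N..int N}"
  define P2 where "P2 = imag_pole ` {- int N..<int N}"
  have D_0: "D w = 0" if "w \<in> P1 \<union> P2" for w
  proof -
    have "sin (of_real pi * w) = 0" if "w \<in> P1"
      using that unfolding P1_def sin_eq_0 by (auto simp: mult.commute)
    moreover have "cos (\<i> * of_real (pi * t) * w) = 0" if "w \<in> P2"
    proof -
      from that obtain k where k: "w = imag_pole k" by (auto simp: P2_def)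
      have "\<i> * of_real (pi * t) * w = of_real ((- k - 1) * pi) + of_real pi / 2"
        using t by (simp add: k imag_pole_def field_simps complex_eq_iff)
      then show ?thesis unfolding cos_eq_0 by (intro exI[of _ "- k - 1"]) simp
    qed
    ultimately show ?thesis using \<open>w \<in> P1 \<union> P2\<close> by (auto simp: D_def)
  qed
  have D_S: "w \<in> P1 \<union> P2" if "D w = 0" "w \<in> S" for w
    using D_zeros[OF that(1)]
  proof (elim disjE exE)
    fix k :: int assume k: "w = of_int k"
    then have "- (real N + 1) < of_int k" "of_int k < real N + 1"
      using that(2) by (auto simp: S_def in_box_complex_iff)
    then have "- int N \<le> k" "k \<le> int N" by linarith+
    then show ?thesis using k by (auto simp: P1_def)
  next
    fix k :: int assume k: "w = \<i> * of_real ((of_int k + 1/2) / t)"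
    then have "- ((real N + 1/2) / t) < (of_int k + 1/2) / t" "(of_int k + 1/2) / t < (real N + 1/2) / t"
      using that(2) by (auto simp: S_def in_box_complex_iff)
    then have "- (real N + 1/2) < of_int k + 1/2" "of_int k + 1/2 < real N + 1/2"
      using t by (simp_all only: minus_divide_left divide_less_cancel)
    then have "- int N \<le> k" "k < int N" by linarith+
    then show ?thesis using k by (auto simp: P2_def imag_pole_def)
  qed
  have path_S: "path_image (rectpath (- b) b) \<subseteq> S"
  proof
    fix w assume w: "w \<in> path_image (rectpath (- b) b)"
    have "real N / t < (real N + 1/2) / t" using t by (simp add: divide_strict_right_mono)
    then show "w \<in> S" using path(2,3)[OF w] by (auto simp: S_def in_box_complex_iff)
  qed
  have inside: "w \<in> box (- b) b" if "w \<in> P1 \<union> P2" for w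
    using that
  proof
    assume "w \<in> P1"
    then obtain k where k: "w = of_int k" "- int N \<le> k" "k \<le> int N" by (auto simp: P1_def)
    then have "- real N \<le> of_int k" "of_int k \<le> real N" by linarith+
    moreover have "real N / t > 0" using t N by simp
    ultimately show ?thesis by (auto simp: in_box_complex_iff Re_b Im_b k(1))
  next
    assume "w \<in> P2"
    then obtain k where k: "w = imag_pole k" "- int N \<le> k" "k < int N" by (auto simp: P2_def)
    then have "- real N < of_int k + 1/2" "of_int k + 1/2 < real N" by linarith+
    then have "(- real N) / t < (of_int k + 1/2) / t" "(of_int k + 1/2) / t < real N / t"
      using divide_strict_right_mono[OF _ t] by blast+
    then show ?thesis by (auto simp: in_box_complex_iff Re_b Im_b k(1) imag_pole_def)
  qed
  have "contour_integral (rectpath (- b) b) G = 2 * pi * \<i> *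
      (\<Sum>w\<in>P1 \<union> P2. winding_number (rectpath (- b) b) w * residue G w)"
  proof (rule Residue_theorem)
    show "open S" "connected S" by (auto simp: S_def intro: convex_connected)
    show "finite (P1 \<union> P2)" by (simp add: P1_def P2_def)
    show "G holomorphic_on S - (P1 \<union> P2)"
      unfolding G_def using D_S by (intro holomorphic_intros holomorphic_on_subset[OF D_holo]) auto
    show "path_image (rectpath (- b) b) \<subseteq> S - (P1 \<union> P2)" using path_S D_path D_0 by blast
    show "\<forall>z. z \<notin> S \<longrightarrow> winding_number (rectpath (- b) b) z = 0"
      using path_S by (intro allI impI winding_number_zero_outside[of _ S]) (auto simp: S_def)
  qed auto
  also have "(\<Sum>w\<in>P1 \<union> P2. winding_number (rectpath (- b) b) w * residue G w) =
      (\<Sum>w\<in>P1 \<union> P2. residue G w)"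
    by (intro sum.cong) (simp_all add: winding_number_rectpath inside)
  also have "\<dots> = (\<Sum>w\<in>P1. residue G w) + (\<Sum>w\<in>P2. residue G w)"
  proof (rule sum.union_disjoint)
    have "of_int i \<noteq> imag_pole k" for i k
    proof
      assume "of_int i = imag_pole k"
      then have "Im (imag_pole k) = 0" by (simp flip: \<open>of_int i = imag_pole k\<close>)
      then have "real_of_int (2 * k + 1) = 0" using t by (simp add: imag_pole_def)
      then have "2 * k + 1 = 0" by (simp only: of_int_eq_0_iff)
      then show False by presburger
    qed
    then show "P1 \<inter> P2 = {}" by (auto simp: P1_def P2_def)
  qed (simp_all add: P1_def P2_def)
  also have "(\<Sum>w\<in>P1. residue G w) = (\<Sum>k\<in>{- int N..int N}. residue G (of_int k))"
    unfolding P1_def by (subst sum.reindex) (auto simp: inj_on_def)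
  also have "(\<Sum>w\<in>P2. residue G w) = (\<Sum>k\<in>{- int N..<int N}. residue G (imag_pole k))"
    unfolding P2_def using t by (subst sum.reindex) (auto simp: inj_on_def imag_pole_def)
  finally show "contour_integral (rectpath (- b) b) G = 2 * pi * \<i> *
      ((\<Sum>k\<in>{- int N..int N}. residue G (of_int k)) + (\<Sum>k\<in>{- int N..<int N}. residue G (imag_pole k)))" .
  \<comment> \<open>The lower right corner; the corners of the rectangle are then
    \<open>- b\<close>, \<open>v\<close>, \<open>b\<close>, \<open>- v\<close>.\<close>
  define v where "v = Complex (Re b) (- Im b)"
  have rect: "rectpath (- b) b =
      linepath (- b) v +++ linepath v b +++ linepath b (- v) +++ linepath (- v) (- b)"
  proof -
    have "Complex (Re (- b)) (Im b) = - v" "Complex (Re b) (Im (- b)) = v"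
      by (simp_all add: v_def complex_eq_iff)
    then show ?thesis by (simp only: rectpath_def Let_def)
  qed
  have segs: "path_image (rectpath (- b) b) =
      closed_segment (- b) v \<union> closed_segment v b \<union> closed_segment b (- v) \<union> closed_segment (- v) (- b)"
    unfolding rect by (auto simp: path_image_join)
  have int: "G contour_integrable_on linepath x y"
    if "closed_segment x y \<subseteq> path_image (rectpath (- b) b)" for x y
    unfolding G_def using that D_path
    by (intro contour_integrable_continuous_linepath continuous_intros holomorphic_on_imp_continuous_on
        holomorphic_on_subset[OF D_holo]) auto
  have ints: "G contour_integrable_on linepath (- b) v" "G contour_integrable_on linepath v b"
    "G contour_integrable_on linepath b (- v)" "G contour_integrable_on linepath (- v) (- b)"
    unfolding segs by (auto intro!: int simp: segs)
  have G_le: "norm (G w) \<le> pi / s" if "s > 0" "s \<le> norm (D w)" for w s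
    using that by (simp add: G_def norm_divide frac_le)
  let ?V = "pi / sinh (pi * t * (real N + 1/2))" and ?H = "pi / sinh (pi * real N / t)"
  have hor: "norm (contour_integral (linepath x y) G) \<le> ?H * (2 * real N + 1)"
    if "G contour_integrable_on linepath x y" "Im x = Im y" "\<bar>Im x\<bar> = real N / t"
      "\<bar>Re y - Re x\<bar> = 2 * real N + 1" for x y
  proof -
    have "norm (contour_integral (linepath x y) G) \<le> ?H * norm (y - x)"
    proof (rule contour_integral_bound_linepath[OF that(1)])
      fix w assume "w \<in> closed_segment x y"
      then have "Im w = Im x" using that(2) by (auto simp: closed_segment_def left_diff_distrib)
      then show "norm (G w) \<le> ?H" using D_hor[of w] that(3) pos by (intro G_le) auto
    qed (use pos in simp)
    also have "norm (y - x) = 2 * real N + 1"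
      using that by (simp add: cmod_def)
    finally show ?thesis .
  qed
  have vert: "norm (contour_integral (linepath x y) G) \<le> ?V * (2 * real N / t)"
    if "G contour_integrable_on linepath x y" "Re x = Re y" "\<bar>Re x\<bar> = real N + 1/2"
      "\<bar>Im y - Im x\<bar> = 2 * real N / t" for x y
  proof -
    have "norm (contour_integral (linepath x y) G) \<le> ?V * norm (y - x)"
    proof (rule contour_integral_bound_linepath[OF that(1)])
      fix w assume "w \<in> closed_segment x y"
      then have "Re w = Re x" using that(2) by (auto simp: closed_segment_def left_diff_distrib)
      then show "norm (G w) \<le> ?V" using D_vert[of w] that(3) pos by (intro G_le) auto
    qed (use pos in simp)
    also have "norm (y - x) = 2 * real N / t"
      using that by (simp add: cmod_def)
    finally show ?thesis .
  qed
  have "contour_integral (rectpath (- b) b) G = contour_integral (linepath (- b) v) G +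
      (contour_integral (linepath v b) G +
       (contour_integral (linepath b (- v)) G + contour_integral (linepath (- v) (- b)) G))"
    unfolding rect using ints by (simp add: contour_integrable_joinI)
  also have "norm \<dots> \<le> ?H * (2 * real N + 1) + (?V * (2 * real N / t) +
       (?H * (2 * real N + 1) + ?V * (2 * real N / t)))"
    using t by (intro order_trans[OF norm_triangle_ineq] add_mono hor vert ints)
       (auto simp: v_def Re_b Im_b)
  finally show "norm (contour_integral (rectpath (- b) b) G) \<le>
      2 * (pi / sinh (pi * t * (real N + 1/2))) * (2 * real N / t) +
      2 * (pi / sinh (pi * real N / t)) * (2 * real N + 1)"
    by (simp add: mult_ac)
qed

text \<open>The side lengths grow linearly in \<open>N\<close>, while the kernel decays
  exponentially on the sides.\<close>

lemma residue_sum_tendsto_0: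
  "(\<lambda>N. (\<Sum>k\<in>{- int N..int N}. residue G (of_int k)) +
         (\<Sum>k\<in>{- int N..<int N}. residue G (imag_pole k))) \<longlonglongrightarrow> 0"
proof (rule Lim_null_comparison)
  let ?B = "\<lambda>N::nat. (2 * (pi / sinh (pi * t * (real N + 1/2))) * (2 * real N / t) +
      2 * (pi / sinh (pi * real N / t)) * (2 * real N + 1)) / (2 * pi)"
  have lim1: "(\<lambda>N. real N / sinh (c * real N + d)) \<longlonglongrightarrow> 0" if "c > 0" for c d
    using that by real_asymp
  have lim2: "(\<lambda>N. (2 * real N + 1) / sinh (c * real N)) \<longlonglongrightarrow> 0" if "c > 0" for c
    using that by real_asymp
  have "?B = (\<lambda>N. (2 / t) * (real N / sinh (pi * t * real N + pi * t / 2)) +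
      (2 * real N + 1) / sinh ((pi / t) * real N))"
    by (simp add: fun_eq_iff add_divide_distrib distrib_left)
  moreover have "\<dots> \<longlonglongrightarrow> (2 / t) * 0 + 0"
    using t by (intro tendsto_intros lim1 lim2) auto
  ultimately show "?B \<longlonglongrightarrow> 0" by simp
  show "\<forall>\<^sub>F N in sequentially. norm ((\<Sum>k\<in>{- int N..int N}. residue G (of_int k)) +
         (\<Sum>k\<in>{- int N..<int N}. residue G (imag_pole k))) \<le> ?B N"
    using eventually_gt_at_top[of 0]
  proof eventually_elim
    case (elim N)
    have "norm s \<le> B / (2 * pi)" if "norm I \<le> B" "I = 2 * pi * \<i> * s" for s I B
      using that by (simp add: norm_mult field_simps)
    from this[OF rectangle_identity(2)[OF elim] rectangle_identity(1)[OF elim]] show ?case .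
  qed
qed

text \<open>The residues agree at \<open>k\<close> and \<open>- k\<close>, and at the imaginary
  poles with indices \<open>k\<close> and \<open>- 1 - k\<close>. Pairing them leaves the
  contribution 1 of the pole at 0 and two sums over the natural numbers, each with a factor 4 once
  the denominators are written with exponentials.\<close>

lemma residue_sum_explicit:
  "(\<lambda>N. 1 + 4 * (\<Sum>n<N. (-1) ^ (n+1) / (exp (of_real (pi * t * (n+1))) +
      exp (- of_real (pi * t * (n+1))))) -
      of_real (1 / t) * (4 * (\<Sum>n<N. (-1) ^ n / (exp (of_real (pi * (n+1/2) / t)) -
          exp (- of_real (pi * (n+1/2) / t)))))) \<longlonglongrightarrow> (0::complex)"
proof -
  have c: "cos (\<i> * z) = (exp z + exp (- z)) / 2" for z :: complex
    by (simp add: cos_i_times exp_minus)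
  have s: "sin (\<i> * z) = \<i> * (exp z - exp (- z)) / 2" for z :: complex
    by (simp add: sin_i_times exp_minus)
  have sgn: "(1::complex) / (-1) ^ n = (-1) ^ n" for n :: nat by (simp add: minus_one_power_iff)
  have int_term: "1 / ((-1) ^ n * (x / 2)) = 2 * ((-1) ^ n / x)" for n and x :: complex
  proof -
    have "1 / ((-1) ^ n * (x / 2)) = (1 / (-1) ^ n) * (2 / x)" by simp
    then show ?thesis unfolding sgn by simp
  qed
  have row_term: "1 / (\<i> * of_real t * (\<i> * x / 2) * (-1) ^ n) = -
      of_real (1 / t) * (2 * ((-1) ^ n / x))"
    for n and x :: complex
  proof -
    have "1 / (\<i> * of_real t * (\<i> * x / 2) * (-1) ^ n) = (1 / (-1) ^ n) * (- of_real (1 / t) * (2 / x))"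
      using t by (cases "x = 0") (simp_all add: field_simps)
    then show ?thesis unfolding sgn by simp
  qed
  have int_sum: "(\<Sum>k\<in>{- int N..int N}. residue G (of_int k)) =
      1 + 4 * (\<Sum>n<N. (-1) ^ (n+1) / (exp (of_real (pi * t * (n+1))) +
          exp (- of_real (pi * t * (n+1)))))" for N
  proof -
    have "residue G (of_int (int n + 1)) =
        2 * ((-1) ^ (n+1) / (exp (of_real (pi * t * (n+1))) + exp (- of_real (pi * t * (n+1)))))" for n
    proof -
      have "cos (of_int (int n + 1) * pi) = (-1) ^ (n+1)"
        using cos_npi[of "n+1"] by (simp only: of_int_add of_int_of_nat_eq of_nat_add of_int_1 of_nat_1)
      moreover have "pi * t * real_of_int (int n + 1) = pi * t * (n + 1)" by simp
      ultimately show ?thesis unfolding residue_G_int c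
        by (simp only: of_real_power of_real_minus of_real_1 int_term)
    qed
    moreover have "residue G (of_int (- k)) = residue G (of_int k)" for k
      unfolding residue_G_int by simp
    moreover have "residue G (of_int 0) = 1" unfolding residue_G_int by simp
    ultimately show ?thesis by (subst sum_even_int) (simp_all add: sum_distrib_left)
  qed
  have row_sum: "(\<Sum>k\<in>{- int N..<int N}. residue G (imag_pole k)) =
      - of_real (1 / t) * (4 * (\<Sum>n<N. (-1) ^ n / (exp (of_real (pi * (n+1/2) / t)) -
          exp (- of_real (pi * (n+1/2) / t)))))" for N
  proof -
    have "residue G (imag_pole (int n)) = - of_real (1 / t) *
        (2 * ((-1) ^ n / (exp (of_real (pi * (n+1/2) / t)) - exp (- of_real (pi * (n+1/2) / t)))))" for n
    proof -
      have "cos (real_of_int (int n) * pi) = (-1) ^ n" by simp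
      then show ?thesis unfolding residue_G_imag_pole s
        by (simp only: of_real_power of_real_minus of_real_1 of_int_of_nat_eq row_term)
    qed
    moreover have "residue G (imag_pole (- 1 - k)) = residue G (imag_pole k)" for k
    proof -
      have "cos (real_of_int (- 1 - k) * pi) = - cos (of_int k * pi)"
      proof -
        have "cos (real_of_int (- 1 - k) * pi) = cos (- (of_int k * pi + pi))"
            by (simp add: algebra_simps)
        also have "\<dots> = - cos (of_int k * pi)" unfolding cos_minus by simp
        finally show ?thesis .
      qed
      moreover have "pi * (real_of_int (- 1 - k) + 1/2) / t = - (pi * (of_int k + 1/2) / t)"
        using t by (simp add: field_simps)
      ultimately show ?thesis unfolding residue_G_imag_pole
        by (simp only: of_real_minus mult_minus_right sin_minus mult_minus_left minus_minus)
    qed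
    ultimately show ?thesis
        by (subst sum_reflected_int) (simp_all add: sum_distrib_left sum_negf sum_divide_distrib)
  qed
  show ?thesis using residue_sum_tendsto_0 unfolding int_sum row_sum by simp
qed

end

text \<open>The two residue sums are partial sums of Lambert series. The integer poles give
  \<open>theta4_disc\<close> at \<open>Q\<close>; the imaginary ones give the alternating form of
  \<open>theta2_disc\<close> at \<open>R\<close>, to which \<open>lambert_swap\<close>
  applies.\<close>

lemma theta4_disc_imaginary_axis:
  assumes t: "t > 0"
  shows "theta4_disc (of_real (exp (- (pi * t / 2)))) =
      of_real (1 / t) * theta2_disc (of_real (exp (- (pi / (2 * t)))))"
proof -
  define Q :: complex where "Q = of_real (exp (- (pi * t / 2)))"
  define R :: complex where "R = of_real (exp (- (pi / (2 * t))))"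
  have Q: "norm Q < 1" and R: "norm R < 1" using t by (simp_all add: Q_def R_def)
  have Q_term: "Q ^ (2*(n+1)) / (1 + Q ^ (2 * (2*(n+1)))) =
      1 / (exp (of_real (pi * t * (n+1))) + exp (- of_real (pi * t * (n+1))))" for n :: nat
  proof -
    define y where "y = pi * t * (n+1)"
    define x :: complex where "x = exp (of_real y)"
    have "Q ^ (2*(n+1)) = of_real (exp (- (pi * t / 2)) ^ (2*(n+1)))" by (simp only: Q_def of_real_power)
    also have "exp (- (pi * t / 2)) ^ (2*(n+1)) = exp (- y)"
      unfolding exp_of_nat_mult[symmetric] y_def by (simp add: field_simps)
    finally have q: "Q ^ (2*(n+1)) = 1 / x" by (simp add: x_def exp_minus exp_of_real inverse_eq_divide)
    have q2: "Q ^ (2 * (2*(n+1))) = (1 / x)\<^sup>2"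
      unfolding q[symmetric] power_mult[symmetric] by (simp only: mult.commute)
    have "x \<noteq> 0" by (simp add: x_def)
    then show ?thesis unfolding q q2 exp_minus y_def[symmetric] x_def[symmetric]
      by (simp add: field_simps power2_eq_square)
  qed
  have R_term: "R ^ (2*n+1) / (1 - R ^ (2 * (2*n+1))) =
      1 / (exp (of_real (pi * (n+1/2) / t)) - exp (- of_real (pi * (n+1/2) / t)))" for n :: nat
  proof -
    define y where "y = pi * (n+1/2) / t"
    define x :: complex where "x = exp (of_real y)"
    have "R ^ (2*n+1) = of_real (exp (- (pi / (2 * t))) ^ (2*n+1))" by (simp only: R_def of_real_power)
    also have "exp (- (pi / (2 * t))) ^ (2*n+1) = exp (- y)"
      unfolding exp_of_nat_mult[symmetric] y_def using t by (simp add: field_simps)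
    finally have q: "R ^ (2*n+1) = 1 / x" by (simp add: x_def exp_minus exp_of_real inverse_eq_divide)
    have q2: "R ^ (2 * (2*n+1)) = (1 / x)\<^sup>2"
      unfolding q[symmetric] power_mult[symmetric] by (simp only: mult.commute)
    have "x \<noteq> 0" by (simp add: x_def)
    then show ?thesis unfolding q q2 exp_minus y_def[symmetric] x_def[symmetric]
      by (simp add: field_simps power2_eq_square)
  qed
  have "(\<lambda>n. (-1) ^ (n+1) * (Q ^ (2*(n+1)) / (1 + Q ^ (2 * (2*(n+1))))))
      sums (\<Sum>n. (-1) ^ (n+1) * (Q ^ (2*(n+1)) / (1 + Q ^ (2 * (2*(n+1))))))"
    by (rule lambert_series(2)) (use Q in \<open>auto simp: norm_power\<close>)
  then have "(\<lambda>N. 1 + 4 * (\<Sum>n<N. (-1) ^ (n+1) * (Q ^ (2*(n+1)) / (1 + Q ^ (2 * (2*(n+1)))))))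
      \<longlonglongrightarrow> theta4_disc Q"
    unfolding theta4_disc_def sums_def by (intro tendsto_intros)
  moreover have "(\<lambda>N. of_real (1 / t) * (4 * (\<Sum>n<N. (-1) ^ n * (R ^ (2*n+1) / (1 - R ^ (2 * (2*n+1)))))))
      \<longlonglongrightarrow> of_real (1 / t) * theta2_disc R"
    unfolding theta2_disc_def lambert_swap(1)[OF R, symmetric]
    using summable_LIMSEQ[OF lambert_swap(2)[OF R]] by (intro tendsto_intros)
  ultimately have "(\<lambda>N. 1 + 4 * (\<Sum>n<N. (-1) ^ (n+1) * (Q ^ (2*(n+1)) / (1 + Q ^ (2 * (2*(n+1)))))) -
      of_real (1 / t) * (4 * (\<Sum>n<N. (-1) ^ n * (R ^ (2*n+1) / (1 - R ^ (2 * (2*n+1)))))))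
      \<longlonglongrightarrow> theta4_disc Q - of_real (1 / t) * theta2_disc R"
    by (rule tendsto_diff)
  then have "theta4_disc Q - of_real (1 / t) * theta2_disc R = 0"
    using residue_sum_explicit[OF t] unfolding Q_term R_term times_divide_eq_right mult_1_right
    by (rule LIMSEQ_unique)
  then show ?thesis by (simp add: Q_def R_def)
qed

section \<open>The inversion formula on the whole upper half plane\<close>

definition qpar :: "complex \<Rightarrow> complex" where
  "qpar z = exp (2 * of_real pi * \<i> * z / 4)"

lemma norm_qpar: "z \<in> uhp \<Longrightarrow> norm (qpar z) < 1"
  by (simp add: qpar_def uhp_def)

lemma qpar_shift: "qpar (z + 1) = \<i> * qpar z" 
proof -
  have "exp (of_real pi * \<i> / 2) = \<i>" using cis_pi_half by (simp add: cis_conv_exp mult.commute)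
  then show ?thesis by (simp add: qpar_def distrib_left add_divide_distrib exp_add mult_ac)
qed

lemma qpar_holo: "qpar holomorphic_on A"
  unfolding qpar_def by (intro holomorphic_intros) auto

lemma uhp_open: "open uhp" and uhp_connected: "connected uhp"
  by (simp_all add: uhp_def open_halfspace_Im_gt convex_connected convex_halfspace_Im_gt)

lemma neg_inverse_in_uhp: "z \<in> uhp \<Longrightarrow> -1 / z \<in> uhp"
  using moebius_in_uhp[of "mat2 0 (-1) 1 0" z] by (simp add: moebius_def)

lemma uhp_nonzero: "z \<in> uhp \<Longrightarrow> z \<noteq> 0" by (auto simp: uhp_def)

lemma lambert_qpar_holo:
  assumes "F holomorphic_on ball 0 1" "g holomorphic_on uhp" "g ` uhp \<subseteq> uhp"
  shows "(\<lambda>z. F (qpar (g z))) holomorphic_on uhp"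
proof -
  have "F \<circ> (qpar \<circ> g) holomorphic_on uhp"
  proof (rule holomorphic_on_compose_gen[OF _ assms(1)])
    show "qpar \<circ> g holomorphic_on uhp"
      by (rule holomorphic_on_compose[OF assms(2) qpar_holo])
    show "(qpar \<circ> g) ` uhp \<subseteq> ball 0 1" using assms(3) norm_qpar by (auto simp: image_subset_iff)
  qed
  then show ?thesis by (simp add: o_def)
qed

text \<open>The difference of the two sides is holomorphic and vanishes on the positive imaginary
  axis, which accumulates at \<open>\<i>\<close>. At \<open>w = \<i> * t\<close> the formula on the
  axis is used with parameter \<open>1 / t\<close>, its factor becoming
  \<open>t = - \<i> * w\<close>.\<close>

lemma theta4_disc_inversion:
  assumes z: "z \<in> uhp"
  shows "theta4_disc (qpar (-1 / z)) = - \<i> * z * theta2_disc (qpar z)"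
proof -
  have "theta4_disc (qpar (-1 / z)) + \<i> * z * theta2_disc (qpar z) = 0"
  proof (rule analytic_continuation[of "\<lambda>z. theta4_disc (qpar (-1 / z)) +
      \<i> * z * theta2_disc (qpar z)" uhp "(\<lambda>t. \<i> * of_real t) ` {0<..}" \<i>])
    show "(\<lambda>z. theta4_disc (qpar (-1 / z)) + \<i> * z * theta2_disc (qpar z)) holomorphic_on uhp"
      using uhp_nonzero neg_inverse_in_uhp
      by (intro holomorphic_intros lambert_qpar_holo theta4_disc_holo lambert_qpar_holo[of theta2_disc "\<lambda>z. z", simplified] theta2_disc_holo) auto
    show "(\<lambda>t. \<i> * of_real t) ` {0<..} \<subseteq> uhp" "\<i> \<in> uhp" by (auto simp: uhp_def)
    show "\<i> islimpt (\<lambda>t. \<i> * of_real t) ` {0<..}"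
      unfolding islimpt_approachable
    proof (intro allI impI)
      fix e :: real assume "e > 0"
      then show "\<exists>x'\<in>(\<lambda>t. \<i> * of_real t) ` {0<..}. x' \<noteq> \<i> \<and> dist x' \<i> < e"
        by (intro bexI[of _ "\<i> * of_real (1 + e / 2)"] conjI imageI)
           (auto simp: dist_norm distrib_left norm_mult complex_eq_iff)
    qed
    show "theta4_disc (qpar (-1 / w)) + \<i> * w * theta2_disc (qpar w) =
        0" if "w \<in> (\<lambda>t. \<i> * of_real t) ` {0<..}" for w
    proof -
      from that obtain t :: real where t: "t > 0" and w: "w = \<i> * of_real t" by auto
      have "qpar (-1 / w) = of_real (exp (- (pi * (1 / t) / 2)))"
        unfolding qpar_def w exp_of_real[symmetric] using t by (simp add: field_simps)
      moreover have "qpar w = of_real (exp (- (pi / (2 * (1 / t)))))"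
        unfolding qpar_def w exp_of_real[symmetric] using t by (simp add: field_simps)
      ultimately show ?thesis
        using theta4_disc_imaginary_axis[of "1 / t"] t by (simp add: w mult.assoc[symmetric])
    qed
  qed (use z uhp_open uhp_connected in auto)
  then show ?thesis by (simp add: add_eq_0_iff)
qed

section \<open>The theta squares as modular forms of level 4\<close>

datatype theta_index = Th2 | Th3 | Th4

fun theta_disc :: "theta_index \<Rightarrow> complex \<Rightarrow> complex" where
  "theta_disc Th2 = theta2_disc"
| "theta_disc Th3 = theta3_disc"
| "theta_disc Th4 = theta4_disc"

definition theta :: "theta_index \<Rightarrow> complex \<Rightarrow> complex" where
  "theta j z = (if z \<in> uhp then theta_disc j (qpar z) else 0)"

lemma theta_disc_holo: "theta_disc j holomorphic_on ball 0 1"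
  by (cases j) (simp_all add: theta2_disc_holo theta3_disc_holo theta4_disc_holo)

lemma theta_holo: "theta j holomorphic_on uhp"
  by (rule holomorphic_transform[OF lambert_qpar_holo[OF theta_disc_holo[of j], of "\<lambda>z. z"]])
     (auto simp: theta_def)

text \<open>The q-expansion is the Taylor series at 0 of the function on the disc.\<close>

lemma theta_q_expansion: "\<exists>a. has_q_expansion 4 (theta j) a \<and> a 0 = theta_disc j 0"
proof -
  define a where "a n = (deriv ^^ n) (theta_disc j) 0 / fact n" for n
  have "has_q_expansion 4 (theta j) a"
    unfolding has_q_expansion_def
  proof
    fix z assume z: "z \<in> uhp"
    have "(\<lambda>n. a n * (qpar z - 0) ^ n) sums theta_disc j (qpar z)"
      unfolding a_def using norm_qpar[OF z] by (intro holomorphic_power_series[OF theta_disc_holo]) simp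
    then show "(\<lambda>n. a n * exp (2 * of_real pi * \<i> * z * of_nat n / of_nat 4)) sums theta j z"
      unfolding q_power using z by (simp add: theta_def qpar_def)
  qed
  then show ?thesis by (intro exI[of _ a]) (simp add: a_def)
qed

lemma uhp_add_1: "z + 1 \<in> uhp \<longleftrightarrow> z \<in> uhp" "z - 1 \<in> uhp \<longleftrightarrow> z \<in> uhp"
  by (simp_all add: uhp_def)

lemma theta_plus_1:
  assumes "z \<in> uhp"
  shows "theta Th2 (z + 1) = \<i> * theta Th2 z" "theta Th3 (z + 1) = theta Th4 z" "theta Th4 (z +
      1) = theta Th3 z"
  using assms norm_qpar[OF assms]
      by (simp_all add: theta_def uhp_add_1 qpar_shift theta2_disc_i theta3_disc_i theta4_disc_i)

lemma theta_minus_1: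
  assumes "z \<in> uhp"
  shows "theta Th2 (z - 1) = - \<i> * theta Th2 z" "theta Th3 (z - 1) = theta Th4 z" "theta Th4 (z -
      1) = theta Th3 z"
  using theta_plus_1[of "z - 1"] assms by (simp_all add: uhp_add_1)

lemma theta_inversion:
  assumes z: "z \<in> uhp"
  shows "theta Th2 (-1 / z) = - \<i> * z * theta Th4 z"
    and "theta Th3 (-1 / z) = - \<i> * z * theta Th3 z"
    and "theta Th4 (-1 / z) = - \<i> * z * theta Th2 z"
proof -
  have inv4: "theta Th4 (-1 / z) = - \<i> * z * theta Th2 z" if "z \<in> uhp" for z
    using theta4_disc_inversion[OF that] that neg_inverse_in_uhp[OF that] by (simp add: theta_def)
  have inv2: "theta Th2 (-1 / z) = - \<i> * z * theta Th4 z" if "z \<in> uhp" for z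
  proof -
    have "theta Th4 (-1 / (-1 / z)) = - \<i> * (-1 / z) * theta Th2 (-1 / z)"
      by (rule inv4[OF neg_inverse_in_uhp[OF that]])
    then show ?thesis using uhp_nonzero[OF that] by (simp add: field_simps)
  qed
  show "theta Th4 (-1 / z) = - \<i> * z * theta Th2 z" "theta Th2 (-1 / z) = - \<i> * z * theta Th4 z"
    using inv4[OF z] inv2[OF z] by auto
  \<comment> \<open>\<open>Th3\<close> is reduced to the other two by the relation
    \<open>S = T^-1 S T^-1 S T^-1\<close> of Moebius maps: \<open>z\<close> goes to
    \<open>y\<close>, then to \<open>w\<close>, then to \<open>-1 / z\<close>. The automorphy
    factors \<open>w\<close> and \<open>y\<close> multiply to \<open>- z\<close>.\<close>
  define y where "y = z - 1"
  define w where "w = -1 / y - 1"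
  have y: "y \<in> uhp" using z by (simp add: y_def uhp_add_1)
  have w: "w \<in> uhp" unfolding w_def uhp_add_1 by (rule neg_inverse_in_uhp[OF y])
  have nz: "y \<noteq> 0" "z \<noteq> 0" using y z uhp_nonzero by auto
  have wy: "w * y = - z" using nz by (simp add: w_def y_def field_simps)
  then have "z = - (w * y)" by simp
  then have "y / z = y / - (w * y)" by (simp only:)
  also have "\<dots> = -1 / w" using nz by simp
  finally have "-1 / w = y / z" by (rule sym)
  then have zw: "-1 / z = -1 / w - 1" using nz by (simp add: y_def diff_divide_distrib)
  have "theta Th3 (-1 / z) = theta Th4 (-1 / w)"
    unfolding zw using theta_minus_1 neg_inverse_in_uhp[OF w] by blast
  also have "\<dots> = - \<i> * w * theta Th2 w" by (rule inv4[OF w])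
  also have "theta Th2 w = - \<i> * theta Th2 (-1 / y)"
    unfolding w_def by (rule theta_minus_1[OF neg_inverse_in_uhp[OF y]])
  also have "theta Th2 (-1 / y) = - \<i> * y * theta Th4 y" by (rule inv2[OF y])
  also have "theta Th4 y = theta Th3 z" unfolding y_def by (rule theta_minus_1[OF z])
  also have "- \<i> * w * (- \<i> * (- \<i> * y * theta Th3 z)) = \<i> * (w * y) * theta Th3 z"
    by (simp add: mult_ac)
  also have "\<dots> = - \<i> * z * theta Th3 z" unfolding wy by simp
  finally show "theta Th3 (-1 / z) = - \<i> * z * theta Th3 z" .
qed

text \<open>
  \<open>cusp_table j ! a ! c\<close> is the constant term of \<open>theta j\<close> slashed by a matrix with first column
  congruent to \<open>(a, c)\<close> modulo 4. The entries are forced by equivariance from the values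
  \<open>0, 1, 1\<close> at \<open>(1, 0)\<close>; those with \<open>a\<close> and \<open>c\<close> both even are junk.
\<close>

fun cusp_table :: "theta_index \<Rightarrow> complex list list" where
  "cusp_table Th2 = [[0, -\<i>, 0, \<i>], [0, 1, 0, 1], [0, \<i>, 0, -\<i>], [0, -1, 0, -1]]"
| "cusp_table Th3 = [[0, -\<i>, 0, \<i>], [1, 0, 1, 0], [0, -\<i>, 0, \<i>], [-1, 0, -1, 0]]"
| "cusp_table Th4 = [[0, 0, 0, 0], [1, -\<i>, -1, \<i>], [0, 0, 0, 0], [-1, -\<i>, 1, \<i>]]"

definition cusp_value :: "theta_index \<Rightarrow> int \<Rightarrow> int \<Rightarrow> complex" where
  "cusp_value j a c = cusp_table j ! nat (a mod 4) ! nat (c mod 4)"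

lemma mod_4_in: "(a::int) mod 4 \<in> {0, 1, 2, 3}"
  by (simp; presburger)

text \<open>A finite check over residues modulo 4 that the table obeys the transformation law of the
  theta squares under \<open>S\<close>, which sends the column \<open>(a, c)\<close> to
  \<open>(- c, a)\<close>; \<open>cusp_value_T\<close> does the same for \<open>T\<close>.\<close>

lemma cusp_value_S:
  "cusp_value Th2 (- c) a = - \<i> * cusp_value Th4 a c"
  "cusp_value Th3 (- c) a = - \<i> * cusp_value Th3 a c"
  "cusp_value Th4 (- c) a = - \<i> * cusp_value Th2 a c"
proof -
  have eq: "cusp_value j (- c) a = cusp_table j ! nat (- (c mod 4) mod 4) ! nat (a mod 4)" for j
    by (simp add: cusp_value_def mod_minus_eq)
  have "\<forall>r\<in>{0, 1, 2, 3::int}. \<forall>s\<in>{0, 1, 2, 3::int}.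
      cusp_table Th2 ! nat (- s mod 4) ! nat r = - \<i> * cusp_table Th4 ! nat r ! nat s \<and>
      cusp_table Th3 ! nat (- s mod 4) ! nat r = - \<i> * cusp_table Th3 ! nat r ! nat s \<and>
      cusp_table Th4 ! nat (- s mod 4) ! nat r = - \<i> * cusp_table Th2 ! nat r ! nat s"
    by simp
  from bspec[OF bspec[OF this mod_4_in[of a]] mod_4_in[of c]] show
    "cusp_value Th2 (- c) a = - \<i> * cusp_value Th4 a c"
    "cusp_value Th3 (- c) a = - \<i> * cusp_value Th3 a c"
    "cusp_value Th4 (- c) a = - \<i> * cusp_value Th2 a c"
    unfolding eq unfolding cusp_value_def by (simp_all only:)
qed

lemma cusp_value_T:
  "cusp_value Th2 (a + c) c = \<i> * cusp_value Th2 a c"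
  "cusp_value Th3 (a + c) c = cusp_value Th4 a c"
  "cusp_value Th4 (a + c) c = cusp_value Th3 a c"
proof -
  have eq: "cusp_value j (a + c) c = cusp_table j ! nat ((a mod 4 +
      c mod 4) mod 4) ! nat (c mod 4)" for j
    by (simp add: cusp_value_def mod_add_eq)
  have "\<forall>r\<in>{0, 1, 2, 3::int}. \<forall>s\<in>{0, 1, 2, 3::int}.
      cusp_table Th2 ! nat ((r + s) mod 4) ! nat s = \<i> * cusp_table Th2 ! nat r ! nat s \<and>
      cusp_table Th3 ! nat ((r + s) mod 4) ! nat s = cusp_table Th4 ! nat r ! nat s \<and>
      cusp_table Th4 ! nat ((r + s) mod 4) ! nat s = cusp_table Th3 ! nat r ! nat s"
    by simp
  from bspec[OF bspec[OF this mod_4_in[of a]] mod_4_in[of c]] show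
    "cusp_value Th2 (a + c) c = \<i> * cusp_value Th2 a c"
    "cusp_value Th3 (a + c) c = cusp_value Th4 a c"
    "cusp_value Th4 (a + c) c = cusp_value Th3 a c"
    unfolding eq unfolding cusp_value_def by (simp_all only:)
qed

text \<open>
  Carrying the constant terms along with the functions makes the action of \<open>\<gamma>\<close> visible modulo 4,
  so that the invariance under \<open>\<Gamma>(4)\<close> follows without knowing generators of \<open>\<Gamma>(4)\<close>.
\<close>

definition theta_maps :: "int^2^2 \<Rightarrow> theta_index \<Rightarrow> complex \<Rightarrow> theta_index \<Rightarrow> bool" where
  "theta_maps \<gamma> j m k \<longleftrightarrow> slash (theta j) \<gamma> = (\<lambda>z. m * theta k z) \<and>
     (\<forall>a c. cusp_value j (\<gamma>$1$1 * a + \<gamma>$1$2 * c) (\<gamma>$2$1 * a + \<gamma>$2$2 * c) = m * cusp_value k a c)"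

lemma theta_mapsI:
  assumes "\<And>z. z \<in> uhp \<Longrightarrow> slash (theta j) \<gamma> z = m * theta k z"
    and "\<And>a c. cusp_value j (\<gamma>$1$1 * a + \<gamma>$1$2 * c) (\<gamma>$2$1 * a + \<gamma>$2$2 * c) = m * cusp_value k a c"
  shows "theta_maps \<gamma> j m k"
proof -
  have "slash (theta j) \<gamma> z = m * theta k z" for z
    using assms(1) by (cases "z \<in> uhp") (auto simp: slash_def theta_def)
  then show ?thesis using assms(2) by (simp add: theta_maps_def fun_eq_iff)
qed

lemma theta_mapsD:
  assumes "theta_maps \<gamma> j m k"
  shows "slash (theta j) \<gamma> = (\<lambda>z. m * theta k z)"
    and "cusp_value j (\<gamma>$1$1 * a + \<gamma>$1$2 * c) (\<gamma>$2$1 * a + \<gamma>$2$2 * c) = m * cusp_value k a c"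
  using assms by (simp_all add: theta_maps_def)

lemma theta_maps_S:
  "theta_maps (mat2 0 (-1) 1 0) Th2 (- \<i>) Th4"
  "theta_maps (mat2 0 (-1) 1 0) Th3 (- \<i>) Th3"
  "theta_maps (mat2 0 (-1) 1 0) Th4 (- \<i>) Th2"
proof -
  have sl: "slash (theta j) (mat2 0 (-1) 1 0) z = - \<i> * theta k z"
    if "z \<in> uhp" "theta j (-1 / z) = - \<i> * z * theta k z" for j k z
    using that uhp_nonzero[OF that(1)] by (simp add: slash_def)
  show "theta_maps (mat2 0 (-1) 1 0) Th2 (- \<i>) Th4"
    using sl[OF _ theta_inversion(1)] cusp_value_S(1) by (intro theta_mapsI) simp_all
  show "theta_maps (mat2 0 (-1) 1 0) Th3 (- \<i>) Th3"
    using sl[OF _ theta_inversion(2)] cusp_value_S(2) by (intro theta_mapsI) simp_all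
  show "theta_maps (mat2 0 (-1) 1 0) Th4 (- \<i>) Th2"
    using sl[OF _ theta_inversion(3)] cusp_value_S(3) by (intro theta_mapsI) simp_all
qed

lemma theta_maps_T:
  "theta_maps (mat2 1 1 0 1) Th2 \<i> Th2"
  "theta_maps (mat2 1 1 0 1) Th3 1 Th4"
  "theta_maps (mat2 1 1 0 1) Th4 1 Th3"
  by (rule theta_mapsI; simp add: slash_def theta_plus_1 cusp_value_T)+

lemma theta_maps_T_inv:
  "theta_maps (mat2 1 (-1) 0 1) Th2 (- \<i>) Th2"
  "theta_maps (mat2 1 (-1) 0 1) Th3 1 Th4"
  "theta_maps (mat2 1 (-1) 0 1) Th4 1 Th3"
proof -
  have "cusp_value Th2 (a - c) c = - \<i> * cusp_value Th2 a c"
    "cusp_value Th3 (a - c) c = cusp_value Th4 a c"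
    "cusp_value Th4 (a - c) c = cusp_value Th3 a c" for a c
    using cusp_value_T[of "a - c" c] by simp_all
  then show "theta_maps (mat2 1 (-1) 0 1) Th2 (- \<i>) Th2"
    "theta_maps (mat2 1 (-1) 0 1) Th3 1 Th4"
    "theta_maps (mat2 1 (-1) 0 1) Th4 1 Th3"
    by (intro theta_mapsI; simp add: slash_def theta_minus_1)+
qed

lemma theta_maps_mult:
  assumes "theta_maps \<alpha> j m k" "theta_maps \<beta> k n l" "det \<beta> > 0"
  shows "theta_maps (\<alpha> ** \<beta>) j (m * n) l"
proof -
  have "slash (theta j) (\<alpha> ** \<beta>) = slash (\<lambda>z. m * theta k z) \<beta>"
    by (simp only: slash_slash[OF assms(3), symmetric] theta_mapsD(1)[OF assms(1)])
  also have "\<dots> = (\<lambda>z. (m * n) * theta l z)"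
    by (simp only: slash_cmult theta_mapsD(1)[OF assms(2)] mult.assoc)
  finally have "slash (theta j) (\<alpha> ** \<beta>) = (\<lambda>z. (m * n) * theta l z)" .
  moreover have "(\<alpha> ** \<beta>)$i$1 * a + (\<alpha> ** \<beta>)$i$2 * c =
      \<alpha>$i$1 * (\<beta>$1$1 * a + \<beta>$1$2 * c) + \<alpha>$i$2 * (\<beta>$2$1 * a + \<beta>$2$2 * c)" for i a c
    by (simp add: algebra_simps)
  ultimately show ?thesis
    unfolding theta_maps_def
    by (simp only: theta_mapsD(2)[OF assms(1)] theta_mapsD(2)[OF assms(2)] mult.assoc simp_thms)
qed

text \<open>Generators permute the three functions up to scalars. The index \<open>j\<close> is
  generalised because the second factor of a product acts on the image \<open>k\<close> of
  \<open>j\<close> under the first.\<close>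

lemma SL2Z_theta_maps:
  assumes "\<gamma> \<in> SL2Z"
  shows "\<exists>m k. theta_maps \<gamma> j m k"
  using assms
proof (induction arbitrary: j rule: SL2Z_induct)
  case S
  show ?case using theta_maps_S by (cases j) blast+
next
  case T
  show ?case using theta_maps_T by (cases j) blast+
next
  case T_inv
  show ?case using theta_maps_T_inv by (cases j) blast+
next
  case (mult \<alpha> \<beta>)
  obtain m k where 1: "theta_maps \<alpha> j m k" using mult(3) by blast
  obtain n l where 2: "theta_maps \<beta> k n l" using mult(4) by blast
  have "det \<beta> > 0" using mult(2) by (simp add: SL2Z_def)
  from theta_maps_mult[OF 1 2 this] show ?case by blast
qed

text \<open>Each table vanishes at exactly one of the columns \<open>(1, 0)\<close>,
  \<open>(0, 1)\<close>, \<open>(1, 1)\<close>, a different one for each index; a nonzero entry then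
  gives the scalar.\<close>

lemma cusp_value_separates:
  assumes "\<And>a c. cusp_value j a c = m * cusp_value k a c"
  shows "k = j \<and> m = 1"
  using assms[of 1 0] assms[of 0 1] assms[of 1 1]
  by (cases j; cases k) (simp_all add: cusp_value_def)

lemma theta_Gamma4_invariant:
  assumes "\<gamma> \<in> principal_congruence_subgroup 4"
  shows "slash (theta j) \<gamma> = theta j"
proof -
  have \<gamma>: "\<gamma> \<in> SL2Z" and cong: "[\<gamma>$1$1 = 1] (mod 4)" "[\<gamma>$1$2 = 0] (mod 4)" "[\<gamma>$2$1 = 0] (mod 4)"
      "[\<gamma>$2$2 = 1] (mod 4)"
    using assms by (auto simp: principal_congruence_subgroup_def forall_2 mat_def)
  obtain m k where mk: "theta_maps \<gamma> j m k" using SL2Z_theta_maps[OF \<gamma>] by blast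
  have "cusp_value j a c = m * cusp_value k a c" for a c
  proof -
    have "[\<gamma>$1$1 * a + \<gamma>$1$2 * c = 1 * a + 0 * c] (mod 4)" "[\<gamma>$2$1 * a + \<gamma>$2$2 * c = 0 * a +
        1 * c] (mod 4)"
      by (intro cong_add cong_mult cong cong_refl)+
    then have "(\<gamma>$1$1 * a + \<gamma>$1$2 * c) mod 4 = a mod 4" "(\<gamma>$2$1 * a + \<gamma>$2$2 * c) mod 4 = c mod 4"
      by (simp_all add: cong_def)
    then show ?thesis using theta_mapsD(2)[OF mk, of a c] by (simp add: cusp_value_def)
  qed
  then have "k = j \<and> m = 1" by (rule cusp_value_separates)
  then show ?thesis using theta_mapsD(1)[OF mk] by simp
qed

text \<open>Evaluated at \<open>(1, 0)\<close>, the law of the table reads off the entry at the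
  first column of \<open>\<gamma>\<close>; on the other side stands \<open>m\<close> times the value
  of \<open>theta_disc k\<close> at 0.\<close>

lemma slash_theta_q_expansion:
  assumes "\<gamma> \<in> SL2Z"
  shows "\<exists>a. has_q_expansion 4 (slash (theta j) \<gamma>) a \<and> a 0 = cusp_value j (\<gamma>$1$1) (\<gamma>$2$1)"
proof -
  obtain m k where mk: "theta_maps \<gamma> j m k" using SL2Z_theta_maps[OF assms] by blast
  obtain a where a: "has_q_expansion 4 (theta k) a" "a 0 = theta_disc k 0"
    using theta_q_expansion by blast
  have "cusp_value k 1 0 = theta_disc k 0" by (cases k) (simp_all add: cusp_value_def theta234_disc_0)
  with theta_mapsD(2)[OF mk, of 1 0] a(2) have "m * a 0 = cusp_value j (\<gamma>$1$1) (\<gamma>$2$1)" by simp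
  with has_q_expansion_cmult[OF a(1), of m] show ?thesis unfolding theta_mapsD(1)[OF mk] by blast
qed

lemma theta_modular_form: "theta j \<in> modular_forms1 4"
  unfolding modular_forms1_def mem_Collect_eq
proof (intro conjI ballI allI impI)
  show "\<exists>a. has_q_expansion 4 (slash (theta j) \<gamma>) a" if "\<gamma> \<in> SL2Z" for \<gamma>
    using slash_theta_q_expansion[OF that, of j] by (elim exE conjE) (rule exI)
qed (simp_all add: theta_holo theta_Gamma4_invariant, simp add: theta_def)

section \<open>Constant terms at the cusps\<close>

text \<open>The two matrices are related by \<open>\<delta>' = \<kappa> \<delta> T^y\<close> with
  \<open>\<kappa>\<close> in the principal congruence subgroup of level 4. The form is invariant
  under \<open>\<kappa>\<close>, and \<open>T^y\<close> preserves constant terms.\<close>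

lemma const_term_slash_cong:
  assumes f: "f \<in> modular_forms1 4" and \<delta>: "\<delta> \<in> SL2Z" and \<delta>': "\<delta>' \<in> SL2Z"
    and cong: "[\<delta>'$1$1 = \<delta>$1$1] (mod 4)" "[\<delta>'$2$1 = \<delta>$2$1] (mod 4)"
  shows "const_term 4 (slash f \<delta>') = const_term 4 (slash f \<delta>)"
proof -
  define a b c d where "a = \<delta>$1$1" and "b = \<delta>$1$2" and "c = \<delta>$2$1" and "d = \<delta>$2$2"
  define b' d' where "b' = \<delta>'$1$2" and "d' = \<delta>'$2$2"
  note defs = a_def b_def c_def d_def b'_def d'_def
  obtain s where s: "\<delta>'$1$1 = a + 4 * s" 
    using cong(1) by (auto simp: cong_iff_dvd_diff a_def dvd_def algebra_simps)
  obtain u where u: "\<delta>'$2$1 = c + 4 * u" 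
    using cong(2) by (auto simp: cong_iff_dvd_diff c_def dvd_def algebra_simps)
  have det1: "a * d - b * c = 1" using SL2Z_det[OF \<delta>] by (simp add: defs)
  have det2: "(a + 4 * s) * d' - b' * (c + 4 * u) = 1" using SL2Z_det[OF \<delta>'] s u by (simp add: defs)
  \<comment> \<open>This \<open>y\<close> makes the second column of \<open>\<delta> T^y\<close>
    congruent to that of \<open>\<delta>'\<close> modulo 4. The error is measured by
    \<open>w\<close>, with \<open>4 w = 1 - (a d' - b' c)\<close> by \<open>det2\<close>.\<close>
  define y where "y = d * b' - b * d'"
  define w where "w = s * d' - u * b'"
  have ay: "a * y + b = b' + 4 * (b * w)" unfolding y_def w_def using det1 det2 by algebra
  have cy: "c * y + d = d' + 4 * (d * w)" unfolding y_def w_def using det1 det2 by algebra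
  \<comment> \<open>The explicit matrix is the inverse of \<open>\<delta> T^y\<close>.\<close>
  define \<kappa> where "\<kappa> = \<delta>' ** mat2 (c * y + d) (- (a * y + b)) (- c) a"
  have \<kappa>: "\<kappa> ** (\<delta> ** mat2 1 y 0 1) = \<delta>'"
  proof -
    have "mat2 (c * y + d) (- (a * y + b)) (- c) a ** (\<delta> ** mat2 1 y 0 1) = mat 1"
      using det1 by (simp add: vec_eq_iff forall_2 mat_def defs algebra_simps)
    then show ?thesis by (simp add: \<kappa>_def matrix_mul_assoc[symmetric])
  qed
  have "mat2 (c * y + d) (- (a * y + b)) (- c) a \<in> SL2Z"
    using det1 by (simp add: SL2Z_def algebra_simps)
  then have "\<kappa> \<in> SL2Z" unfolding \<kappa>_def by (rule SL2Z_mult[OF \<delta>'])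
  moreover have "\<kappa>$1$1 - 1 = 4 * (- w + a * d * w + s * d' + 4 * s * d * w)"
    "\<kappa>$1$2 = 4 * (- (a * b * w) - s * b' - 4 * s * b * w)"
    "\<kappa>$2$1 = 4 * (c * d * w + u * d' + 4 * u * d * w)"
    "\<kappa>$2$2 - 1 = 4 * (- w - c * b * w - u * b' - 4 * u * b * w)"
    unfolding \<kappa>_def matrix_mult_nth_2 mat2_nth ay cy s u b'_def[symmetric] d'_def[symmetric] w_def
    using det2 by (simp_all add: algebra_simps)
  ultimately have "\<kappa> \<in> principal_congruence_subgroup 4"
    by (auto simp: principal_congruence_subgroup_def forall_2 mat_def cong_iff_dvd_diff)
  then have inv: "slash f \<kappa> = f" using f by (simp add: modular_forms1_def)
  have "det (\<delta> ** mat2 1 y 0 1) > 0" using \<delta> by (simp add: SL2Z_def det_mul)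
  then have "slash f \<delta>' = slash (slash f \<kappa>) (\<delta> ** mat2 1 y 0 1)"
    by (simp only: slash_slash \<kappa>)
  then have eq: "slash f \<delta>' = slash (slash f \<delta>) (mat2 1 y 0 1)"
    by (simp add: inv slash_slash)
  obtain e where e: "has_q_expansion 4 (slash f \<delta>) e" using f \<delta> by (auto simp: modular_forms1_def)
  from has_q_expansion_slash_upper[OF this, of 1 4 1 1 y]
  obtain e' where "has_q_expansion 4 (slash f \<delta>') e'" "e' 0 = e 0" by (auto simp: eq)
  then show ?thesis using e by (simp add: const_term_eqI)
qed

text \<open>In weight 1 the matrix \<open>-1\<close> acts as the scalar \<open>-1\<close>, so the
  previous lemma is applied to \<open>\<eta> = - \<delta>\<close>.\<close>

lemma const_term_slash_cong_uminus:
  assumes f: "f \<in> modular_forms1 4" and \<delta>: "\<delta> \<in> SL2Z" and \<delta>': "\<delta>' \<in> SL2Z"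
    and cong: "[\<delta>'$1$1 = - \<delta>$1$1] (mod 4)" "[\<delta>'$2$1 = - \<delta>$2$1] (mod 4)"
  shows "const_term 4 (slash f \<delta>') = - const_term 4 (slash f \<delta>)"
proof -
  define \<eta> where "\<eta> = mat2 (- \<delta>$1$1) (- \<delta>$1$2) (- \<delta>$2$1) (- \<delta>$2$2)"
  have \<eta>: "\<eta> \<in> SL2Z" using SL2Z_det[OF \<delta>] by (simp add: \<eta>_def SL2Z_def)
  obtain e where e: "has_q_expansion 4 (slash f \<delta>) e" using f \<delta> by (auto simp: modular_forms1_def)
  have "slash f \<eta> = (\<lambda>z. -1 * slash f \<delta> z)"
    by (simp add: \<eta>_def slash_uminus_matrix mat2_eta fun_eq_iff)
  then have "const_term 4 (slash f \<eta>) = -1 * e 0"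
    using has_q_expansion_cmult[OF e, of "-1"] by (simp add: const_term_eqI)
  moreover have "const_term 4 (slash f \<delta>') = const_term 4 (slash f \<eta>)"
    using cong by (intro const_term_slash_cong[OF f \<eta> \<delta>']) (simp_all add: \<eta>_def)
  ultimately show ?thesis using e by (simp add: const_term_eqI)
qed

text \<open>Write \<open>\<beta>\<close> as \<open>\<delta>\<close> times an upper triangular matrix
  with diagonal \<open>A\<close>, \<open>D\<close>, where \<open>\<delta>\<close> has the primitive
  first column \<open>(x, y)\<close>. As \<open>A * D\<close> divides \<open>p\<close>, expansions
  in \<open>q^(1/(4p))\<close> suffice.\<close>

lemma slash_upper_decomposition:
  assumes f: "f \<in> modular_forms1 4" and p: "p > 0" and AD: "A > 0" "D > 0" "A * D dvd int p"
    and det: "det \<beta> = A * D" and col: "\<beta>$1$1 = A * x" "\<beta>$2$1 = A * y" and "coprime x y"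
  shows "\<exists>b. has_q_expansion (4 * p) (slash f \<beta>) b \<and>
             b 0 = const_term 4 (slash f (cusp_matrix x y)) / of_int D"
proof -
  define \<delta> where "\<delta> = cusp_matrix x y"
  have \<delta>: "\<delta> \<in> SL2Z" "\<delta>$1$1 = x" "\<delta>$2$1 = y"
    unfolding \<delta>_def using cusp_matrix[OF \<open>coprime x y\<close>] by auto
  \<comment> \<open>The upper right entry of \<open>\<delta>^-1 \<beta>\<close>.\<close>
  define B where "B = \<delta>$2$2 * \<beta>$1$2 - \<delta>$1$2 * \<beta>$2$2"
  have dd: "x * \<delta>$2$2 - \<delta>$1$2 * y = 1" using SL2Z_det[OF \<delta>(1)] by (simp add: \<delta>)
  have "A * (x * \<beta>$2$2 - y * \<beta>$1$2) = A * D"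
    using det by (simp add: det_2 col algebra_simps)
  then have D: "D = x * \<beta>$2$2 - y * \<beta>$1$2" using AD by simp
  have "\<beta>$1$2 = x * B + \<delta>$1$2 * D" "\<beta>$2$2 = y * B + \<delta>$2$2 * D"
    unfolding B_def D using dd by algebra+
  then have \<beta>: "\<beta> = \<delta> ** mat2 A B 0 D"
    by (simp add: vec_eq_iff forall_2 col \<delta> mult.commute)
  have eq: "slash f \<beta> = slash (slash f \<delta>) (mat2 A B 0 D)"
    unfolding \<beta> using AD by (intro slash_slash[symmetric]) simp
  obtain e where e: "has_q_expansion 4 (slash f \<delta>) e" using f \<delta> by (auto simp: modular_forms1_def)
  obtain m where m: "int p = A * D * m" using AD(3) by auto
  then have "m > 0" using p AD by (metis mult_pos_pos of_nat_0_less_iff zero_less_mult_pos)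
  \<comment> \<open>With \<open>p = A D m\<close>, the exponent \<open>A / (4 D)\<close> equals
    \<open>A^2 m / (4 p)\<close>; hence the spacing \<open>k = A * A * m\<close>.\<close>
  have "nat (A * A * m) > 0" "int (nat (A * A * m)) * D * int 4 = A * int (4 * p)"
    using AD \<open>m > 0\<close> m by simp_all
  from has_q_expansion_slash_upper[OF e this(1) _ _ AD(1,2) this(2), of B] p
  have "\<exists>b. has_q_expansion (4 * p) (slash f \<beta>) b \<and> b 0 = e 0 / of_int D"
    unfolding eq by simp
  then show ?thesis using const_term_eqI[OF _ e] by (simp add: \<delta>_def)
qed

section \<open>Proportional constant terms on all of \<open>V p\<close>\<close>

lemma primitive_matrix_if_coprime_row:
  "coprime (\<alpha>$2$1) (\<alpha>$2$2) \<Longrightarrow> primitive_matrix \<alpha>"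
  by (simp add: primitive_matrix_def)

text \<open>Existence of both expansions is built in, so that the condition defines a subspace:
  \<open>const_term\<close> is a definite description and is linear only where expansions
  exist.\<close>

definition const_terms_related :: "nat \<Rightarrow> int^2^2 \<Rightarrow> int^2^2 \<Rightarrow> complex \<Rightarrow> (complex \<Rightarrow> complex) \<Rightarrow> bool" where
  "const_terms_related h \<gamma> \<gamma>' t g \<longleftrightarrow> (\<exists>b b'. has_q_expansion h (slash g \<gamma>) b \<and>
     has_q_expansion h (slash g \<gamma>') b' \<and> b' 0 = t * b 0)"

lemma const_terms_related_const_term:
  "const_terms_related h \<gamma> \<gamma>' t g \<Longrightarrow> h > 0 \<Longrightarrow>
    const_term h (slash g \<gamma>') = t * const_term h (slash g \<gamma>)"
  by (auto simp: const_terms_related_def const_term_eqI)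

lemma const_terms_related_span:
  assumes "g \<in> cfun.span S" "\<And>g. g \<in> S \<Longrightarrow> const_terms_related h \<gamma> \<gamma>' t g"
  shows "const_terms_related h \<gamma> \<gamma>' t g"
  using assms(1)
proof (rule cfun.span_induct)
  show "cfun.subspace (Collect (const_terms_related h \<gamma> \<gamma>' t))"
    unfolding cfun.subspace_def mem_Collect_eq
  proof (intro conjI ballI allI impI)
    have "has_q_expansion h (slash 0 \<alpha>) (\<lambda>_. 0)" for \<alpha>
      by (simp add: has_q_expansion_def slash_def)
    then show "const_terms_related h \<gamma> \<gamma>' t 0"
      unfolding const_terms_related_def by (intro exI[of _ "\<lambda>_. 0"]) simp
  next
    fix f g assume "f \<in> Collect (const_terms_related h \<gamma> \<gamma>' t)"
        "g \<in> Collect (const_terms_related h \<gamma> \<gamma>' t)"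
    then obtain a a' b b' where
      "has_q_expansion h (slash f \<gamma>) a" "has_q_expansion h (slash f \<gamma>') a'" "a' 0 = t * a 0"
      "has_q_expansion h (slash g \<gamma>) b" "has_q_expansion h (slash g \<gamma>') b'" "b' 0 = t * b 0"
      unfolding const_terms_related_def by blast
    then show "const_terms_related h \<gamma> \<gamma>' t (f + g)"
      unfolding const_terms_related_def plus_fun_def slash_add
      by (intro exI[of _ "\<lambda>n. a n + b n"] exI[of _ "\<lambda>n. a' n + b' n"])
         (simp add: has_q_expansion_add distrib_left)
  next
    fix k f assume "f \<in> Collect (const_terms_related h \<gamma> \<gamma>' t)"
    then obtain a a' where
      "has_q_expansion h (slash f \<gamma>) a" "has_q_expansion h (slash f \<gamma>') a'" "a' 0 = t * a 0"
      unfolding const_terms_related_def by blast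
    then show "const_terms_related h \<gamma> \<gamma>' t (\<lambda>z. k * f z)"
      unfolding const_terms_related_def slash_cmult
      by (intro exI[of _ "\<lambda>n. k * a n"] exI[of _ "\<lambda>n. k * a' n"])
         (simp add: has_q_expansion_cmult mult.left_commute)
  qed
qed (use assms(2) in auto)

lemma column_content_dvd_det:
  fixes \<beta> :: "int^2^2"
  shows "gcd (\<beta>$1$1) (\<beta>$2$1) dvd det \<beta>"
  unfolding det_2 by (intro dvd_diff dvd_mult2 dvd_mult gcd_dvd1 gcd_dvd2)

text \<open>The first columns of \<open>\<alpha>\<gamma>'\<close> and
  \<open>\<alpha>\<gamma>\<close> differ by the factor \<open>\<mu>\<close> modulo
  \<open>4p\<close>. Since \<open>p\<close> does not divide \<open>\<mu>\<close>, they have the same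
  content \<open>A\<close>, hence the same \<open>D\<close>; their primitive parts differ by
  \<open>\<epsilon>\<close> modulo 4, which multiplies the constant term by
  \<open>\<epsilon>\<close>.\<close>

lemma const_terms_related_generator:
  assumes p: "prime p" "odd p" and f: "f \<in> modular_forms1 4" and \<alpha>: "det \<alpha> = 1 \<or> det \<alpha> = int p"
    and \<gamma>: "\<gamma> \<in> SL2Z" "\<gamma>' \<in> SL2Z" and \<mu>: "coprime \<mu> (4 * int p)"
    and cong: "[\<gamma>'$1$1 = \<mu> * \<gamma>$1$1] (mod 4 * int p)" "[\<gamma>'$2$1 = \<mu> * \<gamma>$2$1] (mod 4 * int p)"
    and \<epsilon>: "\<epsilon> = 1 \<or> \<epsilon> = -1" "[\<mu> = \<epsilon>] (mod 4)"
  shows "const_terms_related (4 * p) \<gamma> \<gamma>' (of_int \<epsilon>) (slash f \<alpha>)"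
proof -
  define \<beta> \<beta>' where "\<beta> = \<alpha> ** \<gamma>" and "\<beta>' = \<alpha> ** \<gamma>'"
  have det: "det \<beta> = det \<alpha>" "det \<beta>' = det \<alpha>" using \<gamma> by (simp_all add: \<beta>_def \<beta>'_def det_mul SL2Z_def)
  have cong_\<beta>: "[\<beta>'$i$1 = \<mu> * \<beta>$i$1] (mod 4 * int p)" for i
  proof -
    have "[\<beta>'$i$1 = \<alpha>$i$1 * (\<mu> * \<gamma>$1$1) + \<alpha>$i$2 * (\<mu> * \<gamma>$2$1)] (mod 4 * int p)"
      unfolding \<beta>'_def matrix_mult_nth_2 by (intro cong_add cong_mult cong cong_refl)
    then show ?thesis by (simp add: \<beta>_def algebra_simps)
  qed
  have primep: "prime (int p)" using p by simp
  have not_unit: "\<not> is_unit (int p)" using primep by (rule contrapos_pn) (rule not_prime_unit)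
  have "\<not> int p dvd \<mu>"
  proof
    assume "int p dvd \<mu>"
    moreover have "coprime \<mu> (int p)" using \<mu> by simp
    ultimately have "is_unit (int p)" by (meson coprime_common_divisor dvd_refl)
    with not_unit show False by (rule notE)
  qed
  have dvd_iff: "int p dvd \<beta>'$i$1 \<longleftrightarrow> int p dvd \<beta>$i$1" for i
  proof -
    have "[\<beta>'$i$1 = \<mu> * \<beta>$i$1] (mod int p)" using cong_\<beta>[of i] by (rule cong_dvd_modulus) simp
    then have "int p dvd \<beta>'$i$1 \<longleftrightarrow> int p dvd \<mu> * \<beta>$i$1" by (rule cong_dvd_iff)
    then show ?thesis using primep \<open>\<not> int p dvd \<mu>\<close> by (simp add: prime_dvd_mult_iff)
  qed
  define A where "A = gcd (\<beta>$1$1) (\<beta>$2$1)"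
  define A' where "A' = gcd (\<beta>'$1$1) (\<beta>'$2$1)"
  have "A dvd det \<alpha>" "A' dvd det \<alpha>"
      using column_content_dvd_det[of \<beta>] column_content_dvd_det[of \<beta>'] det
          by (simp_all add: A_def A'_def)
  have cases: "B = 1 \<or> B = int p \<and> det \<alpha> = int p" if "B dvd det \<alpha>" "B \<ge> 0" for B
    using \<alpha>
  proof
    assume "det \<alpha> = 1" then show ?thesis using that by simp
  next
    assume "det \<alpha> = int p"
    moreover have "\<forall>m\<ge>0. m dvd int p \<longrightarrow> m = 1 \<or> m = int p"
      using primep unfolding prime_int_iff by simp
    ultimately show ?thesis using that by simp
  qed
  have A: "A = 1 \<or> A = int p \<and> det \<alpha> = int p" using cases \<open>A dvd det \<alpha>\<close> by (simp add: A_def)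
  have A': "A' = 1 \<or> A' = int p \<and> det \<alpha> = int p" using cases \<open>A' dvd det \<alpha>\<close> by (simp add: A'_def)
  have "int p dvd A' \<longleftrightarrow> int p dvd A" by (simp add: A_def A'_def dvd_iff)
  then have AA': "A' = A" using A A' not_unit by (elim disjE conjE) simp_all
  have "A > 0" using A p by (auto simp: prime_gt_0_nat)
  define D where "D = det \<alpha> div A"
  have AD: "A * D = det \<alpha>" using \<open>A dvd det \<alpha>\<close> by (simp add: D_def)
  have "det \<alpha> > 0" "p > 0" using \<alpha> p by (auto simp: prime_gt_0_nat)
  then have "D > 0" using AD \<open>A > 0\<close> zero_less_mult_pos[of A D] by simp
  have AD_dvd: "A * D dvd int p" using AD \<alpha> by auto
  have "A \<noteq> 0" "A' \<noteq> 0" using \<open>A > 0\<close> AA' by simp_all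
  from gcd_coprime_exists[of "\<beta>$1$1" "\<beta>$2$1", folded A_def, OF this(1)]
  obtain x y where xy: "\<beta>$1$1 = A * x" "\<beta>$2$1 = A * y" "coprime x y"
    by (auto simp only: mult.commute[of _ A])
  from gcd_coprime_exists[of "\<beta>'$1$1" "\<beta>'$2$1", folded A'_def, OF \<open>A' \<noteq> 0\<close>, unfolded AA']
  obtain x' y' where xy': "\<beta>'$1$1 = A * x'" "\<beta>'$2$1 = A * y'" "coprime x' y'"
    by (auto simp only: mult.commute[of _ A])
  have "coprime A 4"
  proof -
    have "coprime (int p) (2 ^ 2)" unfolding coprime_power_right_iff using p(2) by simp
    then show ?thesis using A by auto
  qed
  \<comment> \<open>The content, being 1 or the odd prime \<open>p\<close>, can be cancelled modulo
    4.\<close>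
  have red: "[v' = \<epsilon> * v] (mod 4)" if "[A * v' = \<mu> * (A * v)] (mod 4 * int p)" for v v'
  proof -
    have "[A * v' = A * (\<mu> * v)] (mod 4)"
      using cong_dvd_modulus[OF that, of 4] by (simp add: mult.left_commute)
    then have "[v' = \<mu> * v] (mod 4)" using \<open>coprime A 4\<close> by (simp add: cong_mult_lcancel)
    also have "[\<mu> * v = \<epsilon> * v] (mod 4)" using \<epsilon>(2) by (rule cong_scalar_right)
    finally show ?thesis .
  qed
  have cong_xy: "[x' = \<epsilon> * x] (mod 4)" "[y' = \<epsilon> * y] (mod 4)"
    using red cong_\<beta>[of 1] cong_\<beta>[of 2] by (simp_all add: xy xy')
  note cm = cusp_matrix[OF xy(3)] cusp_matrix[OF xy'(3)]
  have const: "const_term 4 (slash f (cusp_matrix x' y')) =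
      of_int \<epsilon> * const_term 4 (slash f (cusp_matrix x y))"
    using \<epsilon>(1)
  proof
    assume "\<epsilon> = 1"
    then show ?thesis using cong_xy by (simp add: const_term_slash_cong[OF f cm(1,4)] cm)
  next
    assume "\<epsilon> = -1"
    then show ?thesis using cong_xy by (simp add: const_term_slash_cong_uminus[OF f cm(1,4)] cm)
  qed
  obtain b where b: "has_q_expansion (4 * p) (slash f \<beta>) b"
    "b 0 = const_term 4 (slash f (cusp_matrix x y)) / of_int D"
    using slash_upper_decomposition[OF f \<open>p > 0\<close> \<open>A > 0\<close> \<open>D > 0\<close> AD_dvd _ xy] det AD by auto
  obtain b' where b': "has_q_expansion (4 * p) (slash f \<beta>') b'"
    "b' 0 = const_term 4 (slash f (cusp_matrix x' y')) / of_int D"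
    using slash_upper_decomposition[OF f \<open>p > 0\<close> \<open>A > 0\<close> \<open>D > 0\<close> AD_dvd _ xy'] det AD by auto
  have "slash (slash f \<alpha>) \<gamma> = slash f \<beta>" "slash (slash f \<alpha>) \<gamma>' = slash f \<beta>'"
    unfolding \<beta>_def \<beta>'_def using \<gamma> by (auto intro!: slash_slash simp: SL2Z_def)
  then show ?thesis using b b' const unfolding const_terms_related_def
    by (intro exI[of _ b] exI[of _ b']) simp
qed

section \<open>Recovering the class of a cusp from the theta squares\<close>

lemma theta_const_term:
  assumes "p > 0" "A > 0" "D > 0" "A * D dvd int p" "det \<beta> = A * D"
    "\<beta>$1$1 = A * x" "\<beta>$2$1 = A * y" "coprime x y"
  shows "const_term (4 * p) (slash (theta j) \<beta>) = cusp_value j x y / of_int D"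
proof -
  note cm = cusp_matrix[OF \<open>coprime x y\<close>]
  obtain e where e: "has_q_expansion 4 (slash (theta j) (cusp_matrix x y)) e" "e 0 = cusp_value j x y"
    using slash_theta_q_expansion[OF cm(1)] cm(2,3) by metis
  obtain b where "has_q_expansion (4 * p) (slash (theta j) \<beta>) b"
    "b 0 = const_term 4 (slash (theta j) (cusp_matrix x y)) / of_int D"
    using slash_upper_decomposition[OF theta_modular_form assms] by blast
  then show ?thesis using e \<open>p > 0\<close> by (simp add: const_term_eqI)
qed

text \<open>At \<open>(1, 0)\<close> the values are 0, 1, 1. Vanishing for \<open>Th2\<close> forces
  \<open>w\<close> even or a junk entry; for \<open>w\<close> congruent to 2 the values of
  \<open>Th3\<close> and \<open>Th4\<close> are opposite, and junk entries would give
  \<open>t = 0\<close>. For \<open>4 dvd w\<close> the remaining values are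
  \<open>\<plusminus>1\<close>.\<close>

lemma cusp_value_proportional:
  assumes "\<And>j. cusp_value j u w = t * cusp_value j 1 0" "t \<noteq> 0"
  shows "4 dvd w" "norm t = 1"
proof -
  have "\<forall>r\<in>{0, 1, 2, 3::int}. \<forall>s\<in>{0, 1, 2, 3::int}.
      cusp_table Th2 ! nat r ! nat s = 0 \<and> cusp_table Th3 ! nat r ! nat s = t \<and>
      cusp_table Th4 ! nat r ! nat s = t \<longrightarrow> s = 0 \<and> norm t = 1"
    using assms(2) by auto
  from bspec[OF bspec[OF this mod_4_in[of u]] mod_4_in[of w]]
  have "w mod 4 = 0 \<and> norm t = 1"
    using assms(1)[of Th2] assms(1)[of Th3] assms(1)[of Th4] by (simp add: cusp_value_def)
  then show "4 dvd w" "norm t = 1" by auto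
qed

lemma norm_cusp_value_Th3: "norm (cusp_value Th3 a c) \<le> 1"
proof -
  have "\<forall>r\<in>{0, 1, 2, 3::int}. \<forall>s\<in>{0, 1, 2, 3::int}. norm (cusp_table Th3 ! nat r ! nat s) \<le> 1"
    by simp
  from bspec[OF bspec[OF this mod_4_in[of a]] mod_4_in[of c]] show ?thesis
    by (simp only: cusp_value_def)
qed

lemma proj_point_eq_iff:
  "proj_point d v = proj_point d w \<longleftrightarrow> (\<exists>t. t \<noteq> 0 \<and> (\<forall>i\<in>{1..d}. w i = t * v i))"
proof
  assume "proj_point d v = proj_point d w"
  moreover have "w \<in> proj_point d w"
    unfolding proj_point_def by (intro CollectI exI[of _ 1]) simp
  ultimately have "w \<in> proj_point d v" by simp
  then show "\<exists>t. t \<noteq> 0 \<and> (\<forall>i\<in>{1..d}. w i = t * v i)" by (simp only: proj_point_def mem_Collect_eq)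
next
  assume "\<exists>t. t \<noteq> 0 \<and> (\<forall>i\<in>{1..d}. w i = t * v i)"
  then obtain t where t: "t \<noteq> 0" "\<And>i. i \<in> {1..d} \<Longrightarrow> w i = t * v i" by blast
  show "proj_point d v = proj_point d w"
    unfolding proj_point_def
  proof (intro Collect_cong iffI; elim exE conjE)
    fix x s assume "s \<noteq> 0" "\<forall>i\<in>{1..d}. x i = s * v i"
    then show "\<exists>t. t \<noteq> 0 \<and> (\<forall>i\<in>{1..d}. x i = t * w i)"
      using t by (intro exI[of _ "s / t"]) simp
  next
    fix x s assume "s \<noteq> 0" "\<forall>i\<in>{1..d}. x i = s * w i"
    then show "\<exists>t. t \<noteq> 0 \<and> (\<forall>i\<in>{1..d}. x i = t * v i)"
      using t by (intro exI[of _ "s * t"]) simp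
  qed
qed

lemma V_generator:
  "\<lbrakk>f \<in> modular_forms1 4; primitive_matrix \<alpha>; det \<alpha> = 1 \<or> det \<alpha> = int p\<rbrakk> \<Longrightarrow> slash f \<alpha> \<in> V p"
  unfolding V_def by (intro cfun.span_base) blast

text \<open>The case \<open>\<mu> = \<epsilon> = 1\<close>, used to provide every element of
  \<open>V p\<close> with an expansion at every cusp.\<close>

lemma const_terms_related_self:
  assumes "prime p" "odd p" "g \<in> V p" "\<gamma> \<in> SL2Z"
  shows "const_terms_related (4 * p) \<gamma> \<gamma> 1 g"
  using assms(3) unfolding V_def
proof (rule const_terms_related_span)
  fix g assume "g \<in> {slash f \<alpha> |f \<alpha>. f \<in> modular_forms1 4 \<and> primitive_matrix \<alpha> \<and> (det \<alpha> =
      1 \<or> det \<alpha> = int p)}"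
  then show "const_terms_related (4 * p) \<gamma> \<gamma> 1 g"
    using const_terms_related_generator[OF assms(1,2) _ _ assms(4,4), of _ _ 1 1] by fastforce
qed

theorem theorem3p5:
  fixes p d :: nat
    and f :: "nat \<Rightarrow> complex \<Rightarrow> complex"
    and a c a' c' :: int
  assumes "prime p" and "odd p"
    and "is_basis d f (V p)"
    and "coprime a c" and "coprime a' c'"
  shows "F_at_cusp p d f a c = F_at_cusp p d f a' c' \<longleftrightarrow>
    (\<exists>\<mu>::int. coprime \<mu> (4 * int p) \<and>
       [a' = \<mu> * a] (mod 4 * int p) \<and> [c' = \<mu> * c] (mod 4 * int p))"
proof -
  define \<gamma> \<gamma>' where "\<gamma> = cusp_matrix a c" and "\<gamma>' = cusp_matrix a' c'"
  have \<gamma>: "\<gamma> \<in> SL2Z" "\<gamma>$1$1 = a" "\<gamma>$2$1 = c" and \<gamma>': "\<gamma>' \<in> SL2Z" "\<gamma>'$1$1 = a'" "\<gamma>'$2$1 = c'"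
    using cusp_matrix assms(4,5) by (simp_all add: \<gamma>_def \<gamma>'_def)
  have p: "p > 0" "p > 1" using assms(1) prime_gt_0_nat prime_gt_1_nat by auto
  have span: "cfun.span (f ` {1..d}) = V p" using assms(3) by (simp add: is_basis_def)
  have fV: "f i \<in> V p" if "i \<in> {1..d}" for i
    using that span cfun.span_base[of "f i" "f ` {1..d}"] by blast
  show ?thesis
  proof
    assume "F_at_cusp p d f a c = F_at_cusp p d f a' c'"
    then obtain t where t: "t \<noteq> 0" and
      tf: "\<And>i. i \<in> {1..d} \<Longrightarrow> const_term (4 * p) (slash (f i) \<gamma>') = t * const_term (4 * p) (slash (f i) \<gamma>)"
      unfolding F_at_cusp_def proj_point_eq_iff \<gamma>_def \<gamma>'_def by blast
    \<comment> \<open>The scalar \<open>t\<close> works for the basis, hence by linearity for all of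
      \<open>V p\<close>, in particular for the test functions built from the theta squares.\<close>
    have V_t: "const_term (4 * p) (slash g \<gamma>') = t * const_term (4 * p) (slash g \<gamma>)" if "g \<in> V p" for g
    proof -
      have "const_terms_related (4 * p) \<gamma> \<gamma>' t (f i)" if i: "i \<in> {1..d}" for i
      proof -
        obtain b b' where "has_q_expansion (4 * p) (slash (f i) \<gamma>) b"
            "has_q_expansion (4 * p) (slash (f i) \<gamma>') b'"
          using const_terms_related_self[OF assms(1,2) fV[OF i]] \<gamma>(1) \<gamma>'(1)
          unfolding const_terms_related_def by blast
        moreover from this have "b' 0 = t * b 0" using tf[OF i] p by (simp add: const_term_eqI)
        ultimately show ?thesis unfolding const_terms_related_def by blast
      qed
      then have "const_terms_related (4 * p) \<gamma> \<gamma>' t g"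
        using that unfolding span[symmetric] by (intro const_terms_related_span[of g "f ` {1..d}"]) auto
      then show ?thesis using p by (intro const_terms_related_const_term) auto
    qed
    \<comment> \<open>\<open>\<delta>\<close> is the inverse of \<open>\<gamma>\<close>; it moves
      the first cusp to \<open>(1, 0)\<close> and the second to \<open>(u, w)\<close>.\<close>
    define \<delta> where "\<delta> = mat2 (\<gamma>$2$2) (- \<gamma>$1$2) (- c) a"
    have det: "a * \<gamma>$2$2 - \<gamma>$1$2 * c = 1" using SL2Z_det[OF \<gamma>(1)] by (simp add: \<gamma>)
    have \<delta>: "\<delta> \<in> SL2Z" using det by (simp add: \<delta>_def SL2Z_def algebra_simps)
    have \<delta>\<gamma>: "\<delta> ** \<gamma> = mat2 1 0 0 1"
      using det by (simp add: \<delta>_def vec_eq_iff forall_2 \<gamma> algebra_simps)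
    define \<eta> where "\<eta> = \<delta> ** \<gamma>'"
    have \<eta>: "\<eta> \<in> SL2Z" unfolding \<eta>_def by (rule SL2Z_mult[OF \<delta> \<gamma>'(1)])
    define u w where "u = \<eta>$1$1" and "w = \<eta>$2$1"
    have uw: "coprime u w" unfolding u_def w_def by (rule SL2Z_coprime_column[OF \<eta>])
    have a': "a' = a * u + \<gamma>$1$2 * w" and c': "c' = c * u + \<gamma>$2$2 * w"
      unfolding u_def w_def \<eta>_def matrix_mult_nth_2 \<delta>_def mat2_nth \<gamma>' using det by algebra+
    have slash_\<delta>: "slash (slash (theta j) \<alpha>) \<gamma> = slash (theta j) (\<alpha> ** \<gamma>)"
      "slash (slash (theta j) \<alpha>) \<gamma>' = slash (theta j) (\<alpha> ** \<gamma>')" for j \<alpha>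
      using \<gamma>(1) \<gamma>'(1) by (auto intro!: slash_slash simp: SL2Z_def)
    \<comment> \<open>Test functions of determinant 1: \<open>theta j\<close> slashed by
      \<open>\<delta>\<close>, compared at the two cusps.\<close>
    have "cusp_value j u w = t * cusp_value j 1 0" for j
    proof -
      have "slash (theta j) \<delta> \<in> V p"
        using \<delta> SL2Z_coprime_row[OF \<delta>]
        by (intro V_generator theta_modular_form primitive_matrix_if_coprime_row) (simp_all add: SL2Z_def)
      from V_t[OF this] have "const_term (4 * p) (slash (theta j) \<eta>) =
          t * const_term (4 * p) (slash (theta j) (mat2 1 0 0 1))"
        by (simp add: slash_\<delta> \<delta>\<gamma> \<eta>_def)
      moreover have "const_term (4 * p) (slash (theta j) \<eta>) = cusp_value j u w / of_int 1"
        using \<eta> uw p by (intro theta_const_term[of p 1]) (simp_all add: SL2Z_def u_def w_def)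
      moreover have "const_term (4 * p) (slash (theta j) (mat2 1 0 0 1)) = cusp_value j 1 0 / of_int 1"
        using p by (intro theta_const_term[of p 1]) simp_all
      ultimately show ?thesis by simp
    qed
    from cusp_value_proportional[OF this t] have "4 dvd w" "norm t = 1" by auto
    \<comment> \<open>Test function of determinant \<open>p\<close>: \<open>theta Th3\<close>
      slashed by \<open>diag(p, 1) \<delta>\<close>. At the first cusp the column is
      \<open>(p, 0)\<close>, so \<open>D = 1\<close> and the constant term is 1. If \<open>p\<close>
      did not divide \<open>w\<close>, the column \<open>(p u, w)\<close> at the second cusp would
      be primitive, so \<open>D = p\<close> and \<open>norm t \<le> 1 / p\<close>.\<close>
    have "int p dvd w"
    proof (rule ccontr)
      assume "\<not> int p dvd w"
      then have "coprime (int p) w" using assms(1) by (simp add: prime_imp_coprime)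
      then have cop: "coprime (int p * u) w" using uw by simp
      define \<alpha> where "\<alpha> = mat2 (int p) 0 0 1 ** \<delta>"
      have "det \<alpha> = int p" using \<delta> by (simp add: \<alpha>_def det_mul SL2Z_def)
      moreover have "primitive_matrix \<alpha>"
        using SL2Z_coprime_row[OF \<delta>] by (intro primitive_matrix_if_coprime_row) (simp add: \<alpha>_def)
      ultimately have V: "slash (theta Th3) \<alpha> \<in> V p"
        by (intro V_generator theta_modular_form) simp_all
      have \<alpha>\<gamma>: "\<alpha> ** \<gamma> = mat2 (int p) 0 0 1" "\<alpha> ** \<gamma>' = mat2 (int p) 0 0 1 ** \<eta>"
        unfolding \<alpha>_def \<eta>_def matrix_mul_assoc[symmetric] \<delta>\<gamma> by (simp_all add: mat2_mult)
      have "const_term (4 * p) (slash (theta Th3) (mat2 (int p) 0 0 1 ** \<eta>)) =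
          t * const_term (4 * p) (slash (theta Th3) (mat2 (int p) 0 0 1))"
        using V_t[OF V] unfolding slash_\<delta> \<alpha>\<gamma> .
      moreover have "const_term (4 * p) (slash (theta Th3) (mat2 (int p) 0 0 1 ** \<eta>)) =
          cusp_value Th3 (int p * u) w / of_int (int p)"
        using \<eta> cop p by (intro theta_const_term[of p 1]) (simp_all add: det_mul SL2Z_def u_def w_def)
      moreover have "const_term (4 * p) (slash (theta Th3) (mat2 (int p) 0 0 1)) =
          cusp_value Th3 1 0 / of_int 1"
        using p by (intro theta_const_term[of p "int p"]) simp_all
      ultimately have "cusp_value Th3 (int p * u) w / of_nat p = t * cusp_value Th3 1 0" by simp
      moreover have "cusp_value Th3 1 0 = 1" by (simp add: cusp_value_def)
      ultimately have "t = cusp_value Th3 (int p * u) w / of_nat p" by simp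
      then have "norm t = norm (cusp_value Th3 (int p * u) w) / p"
        by (simp only: norm_divide norm_of_nat)
      also have "\<dots> \<le> 1 / p" using norm_cusp_value_Th3 by (intro divide_right_mono) auto
      also have "\<dots> < 1" using p by simp
      finally show False using \<open>norm t = 1\<close> by simp
    qed
    moreover have "coprime 4 (int p)"
    proof -
      have "coprime (2 ^ 2) (int p)" using assms(2) by (simp only: coprime_power_left_iff) simp
      then show ?thesis by simp
    qed
    ultimately have w4p: "4 * int p dvd w" using \<open>4 dvd w\<close> by (intro divides_mult)
    show "\<exists>\<mu>::int. coprime \<mu> (4 * int p) \<and>
       [a' = \<mu> * a] (mod 4 * int p) \<and> [c' = \<mu> * c] (mod 4 * int p)"
    \<comment> \<open>Modulo \<open>4p\<close> the terms with \<open>w\<close> disappear from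
      \<open>a'\<close> and \<open>c'\<close>, leaving the factor \<open>u\<close>, which is a unit
      because it is coprime to \<open>w\<close>.\<close>
    proof (intro exI[of _ u] conjI)
      show "coprime u (4 * int p)" using uw w4p by (rule coprime_divisors[OF dvd_refl, rotated])
      show "[a' = u * a] (mod 4 * int p)" "[c' = u * c] (mod 4 * int p)"
        using w4p by (simp_all add: a' c' cong_iff_dvd_diff mult.commute)
    qed
  next
    assume "\<exists>\<mu>::int. coprime \<mu> (4 * int p) \<and>
       [a' = \<mu> * a] (mod 4 * int p) \<and> [c' = \<mu> * c] (mod 4 * int p)"
    then obtain \<mu> where \<mu>: "coprime \<mu> (4 * int p)" "[a' = \<mu> * a] (mod 4 * int p)" "[c' =
        \<mu> * c] (mod 4 * int p)"
      by blast
    have "odd \<mu>"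
    proof
      assume "even \<mu>"
      moreover have "even (4 * int p)" by simp
      ultimately have "is_unit (2 :: int)" by (rule coprime_common_divisor[OF \<mu>(1)])
      then show False by simp
    qed
    then have mod4: "\<mu> mod 4 = 1 \<or> \<mu> mod 4 = 3" by presburger
    \<comment> \<open>The residue of the odd number \<open>\<mu>\<close> modulo 4, taken as a sign;
      it serves as the common projective factor for all of \<open>V p\<close>.\<close>
    define \<epsilon> :: int where "\<epsilon> = (if \<mu> mod 4 = 1 then 1 else -1)"
    have \<epsilon>: "\<epsilon> = 1 \<or> \<epsilon> = -1" "[\<mu> = \<epsilon>] (mod 4)"
      using mod4 by (auto simp: \<epsilon>_def cong_def)
    have "const_terms_related (4 * p) \<gamma> \<gamma>' (of_int \<epsilon>) g" if "g \<in> V p" for g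
      using that unfolding V_def
    proof (rule const_terms_related_span)
      fix g assume "g \<in> {slash f \<alpha> |f \<alpha>. f \<in> modular_forms1 4 \<and> primitive_matrix \<alpha> \<and> (det \<alpha> =
          1 \<or> det \<alpha> = int p)}"
      then show "const_terms_related (4 * p) \<gamma> \<gamma>' (of_int \<epsilon>) g"
        using const_terms_related_generator[OF assms(1,2) _ _ \<gamma>(1) \<gamma>'(1) \<mu>(1) _ _ \<epsilon>] \<mu> \<gamma> \<gamma>' by auto
    qed
    then have "const_term (4 * p) (slash (f i) \<gamma>') = of_int \<epsilon> * const_term (4 * p) (slash (f i) \<gamma>)"
      if "i \<in> {1..d}" for i
      using const_terms_related_const_term fV[OF that] p by simp
    moreover have "(of_int \<epsilon> :: complex) \<noteq> 0" using \<epsilon>(1) by auto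
    ultimately show "F_at_cusp p d f a c = F_at_cusp p d f a' c'"
      unfolding F_at_cusp_def proj_point_eq_iff \<gamma>_def[symmetric] \<gamma>'_def[symmetric] by blast
  qed
qed

end
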